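(* Let $\mathfrak{g}$ be a Born Lie algebra, i.e. a Lie algebra admitting an integrable Born structure. Then for every integrable Born structure $(h,J,\mathfrak{g}_\pm)$ on $\mathfrak{g}$ there exist a pair of representations $\varphi\colon\mathfrak{g}_-\to\mathrm{End}(\mathfrak{g}_+)$ and $\rho\colon\mathfrak{g}_+\to\mathrm{End}(\mathfrak{g}_-)$ (satisfying the bicross compatibility conditions) and a linear isometry $Q\colon(\mathfrak{g}_+,h_+:=h|_{\mathfrak{g}_+})\to(\mathfrak{g}_-,h_-:=h|_{\mathfrak{g}_-})$ such that $\mathfrak{g}\cong\mathfrak{g}_+\bowtie_\varphi^\rho\mathfrak{g}_-$ and $(h,J,\mathfrak{g}_\pm)$ is equivalent to the Born structure associated with the data $(\mathfrak{g}_\pm,h_\pm,Q,\varphi,\rho)$.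
   Context: All Lie algebras are real and finite-dimensional. A pseudo-Riemannian metric on a Lie algebra is a non-degenerate symmetric bilinear form of arbitrary signature. Born structures. For non-degenerate bilinear forms $a,b$ on a vector space, the recursion operator from $a$ to $b$ is the unique invertible endomorphism $A$ with $a(A\cdot,\cdot)=b(\cdot,\cdot)$. A Born structure on a Lie algebra $\mathfrak{g}$ is a triple $(g,h,\omega)$ of two pseudo-Riemannian metrics $g,h$ and a non-degenerate two-form $\omega$ such that the recursion operators $A$ from $g$ to $\omega$, $B$ from $g$ to $h$ and $-J$ from $\omega$ to $h$ satisfy $A^2=B^2=-J^2=\mathrm{Id}$. It is integrable if $\omega$ is closed under the Chevalley–Eilenberg differential, the Nijenhuis tensor of $J$ vanishes, and the $\pm1$-eigenspaces of $A$ are subalgebras. A Born structure is equivalently encoded as $(h,J,\mathfrak{g}_\pm)$, where $J^2=-\mathrm{Id}$, $h(J\cdot,J\cdot)=h$, and $\mathfrak{g}=\mathfrak{g}_+\oplus\mathfrak{g}_-$ is an $h$-orthogonal splitting whose summands (the $\pm1$-eigenspaces of $A$) are interchanged by $J$; then $\omega=h(J\cdot,\cdot)$ and $g=\omega(A\cdot,\cdot)$. Two Born structures $(g,h,\omega)$ on $\mathfrak{g}$ and $(g',h',\omega')$ on $\mathfrak{g}'$ are equivalent if there is a Lie algebra isomorphism $\Phi\colon\mathfrak{g}\to\mathfrak{g}'$ with $\Phi^*h'=h$, $\Phi^*g'=g$, $\Phi^*\omega'=\omega$. Bicross product. Representations $\varphi\colon\mathfrak{g}_-\to\mathrm{End}(\mathfrak{g}_+)$,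 $\rho\colon\mathfrak{g}_+\to\mathrm{End}(\mathfrak{g}_-)$ satisfy the bicross compatibility conditions if for all $X_+,Y_+\in\mathfrak{g}_+$, $X_-,Y_-\in\mathfrak{g}_-$: $$\varphi(X_-)[X_+,Y_+]_+-[\varphi(X_-)X_+,Y_+]_+-[X_+,\varphi(X_-)Y_+]_++\varphi(\rho(X_+)X_-)Y_+-\varphi(\rho(Y_+)X_-)X_+=0,$$ $$\rho(X_+)[X_-,Y_-]_--[\rho(X_+)X_-,Y_-]_--[X_-,\rho(X_+)Y_-]_-+\rho(\varphi(X_-)X_+)Y_--\rho(\varphi(Y_-)X_+)X_-=0,$$ where $[\cdot,\cdot]_\pm$ are the brackets of $\mathfrak{g}_\pm$. Then $\mathfrak{g}_+\bowtie_\varphi^\rho\mathfrak{g}_-$ is the Lie algebra on the vector space $\mathfrak{g}_+\oplus\mathfrak{g}_-$ with bracket $$[X_++X_-,Y_++Y_-]=[X_+,Y_+]_++\varphi(X_-)Y_+-\varphi(Y_-)X_++[X_-,Y_-]_-+\rho(X_+)Y_--\rho(Y_+)X_-.$$ Associated Born structure. The Born structure associated with the data $(\mathfrak{g}_\pm,h_\pm,Q,\varphi,\rho)$ is the one on $\mathfrak{g}_+\bowtie_\varphi^\rho\mathfrak{g}_-$ encoded by $(h_+\oplus h_-,J_Q,\mathfrak{g}_\pm)$ with $J_Q=\begin{pmatrix}0&-Q^{-1}\\Q&0\end{pmatrix}$ in the splitting $\mathfrak{g}_+\oplus\mathfrak{g}_-$. *)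

theory Defs
  imports "HOL-Analysis.Product_Vector" "HOL-Library.FuncSet"
begin

section \<open>Linear maps and bilinear forms on carriers\<close>

text \<open>
  Vector spaces are carried by subspaces of an ambient type of class \<open>real_vector\<close>. Maps, brackets
  and forms are total functions of the ambient type, and only their values on the carrier matter.
\<close>

definition finite_dim_space :: "'a::real_vector set \<Rightarrow> bool" where
  "finite_dim_space V \<longleftrightarrow> subspace V \<and> (\<exists>B. finite B \<and> span B = V)"

definition lin_map :: "'a::real_vector set \<Rightarrow> 'b::real_vector set \<Rightarrow> ('a \<Rightarrow> 'b) \<Rightarrow> bool" where
  "lin_map V W f \<longleftrightarrow> f \<in> V \<rightarrow> W \<and> (\<forall>x\<in>V. \<forall>y\<in>V. f (x + y) = f x + f y)
     \<and> (\<forall>c. \<forall>x\<in>V. f (c *\<^sub>R x) = c *\<^sub>R f x)"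

type_synonym 'a form = "'a \<Rightarrow> 'a \<Rightarrow> real"

definition bilinear_form :: "'a::real_vector set \<Rightarrow> 'a form \<Rightarrow> bool" where
  "bilinear_form V a \<longleftrightarrow> (\<forall>x\<in>V. lin_map V UNIV (a x)) \<and> (\<forall>y\<in>V. lin_map V UNIV (\<lambda>x. a x y))"

definition nondegenerate :: "'a::real_vector set \<Rightarrow> 'a form \<Rightarrow> bool" where
  "nondegenerate V a \<longleftrightarrow> (\<forall>x\<in>V. (\<forall>y\<in>V. a x y = 0) \<longrightarrow> x = 0)"

definition pseudo_riemannian :: "'a::real_vector set \<Rightarrow> 'a form \<Rightarrow> bool" where
  "pseudo_riemannian V h \<longleftrightarrow>
     bilinear_form V h \<and> nondegenerate V h \<and> (\<forall>x\<in>V. \<forall>y\<in>V. h x y = h y x)"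

definition nondegenerate_two_form :: "'a::real_vector set \<Rightarrow> 'a form \<Rightarrow> bool" where
  "nondegenerate_two_form V w \<longleftrightarrow>
     bilinear_form V w \<and> nondegenerate V w \<and> (\<forall>x\<in>V. \<forall>y\<in>V. w x y = - w y x)"

definition is_recursion_operator ::
    "'a::real_vector set \<Rightarrow> 'a form \<Rightarrow> 'a form \<Rightarrow> ('a \<Rightarrow> 'a) \<Rightarrow> bool" where
  "is_recursion_operator V a b A \<longleftrightarrow>
     lin_map V V A \<and> bij_betw A V V \<and> (\<forall>x\<in>V. \<forall>y\<in>V. a (A x) y = b x y)"

text \<open>
  Restricting to \<open>extensional V\<close> makes the operator unique as a total function; existence and
  uniqueness are the lemmas \<open>recursion_operator_ex\<close> and \<open>recursion_operator_eqI\<close> below.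
\<close>

definition recursion_operator ::
    "'a::real_vector set \<Rightarrow> 'a form \<Rightarrow> 'a form \<Rightarrow> 'a \<Rightarrow> 'a" where
  "recursion_operator V a b = (THE A. A \<in> extensional V \<and> is_recursion_operator V a b A)"

definition eigenspace :: "'a::real_vector set \<Rightarrow> ('a \<Rightarrow> 'a) \<Rightarrow> real \<Rightarrow> 'a set" where
  "eigenspace V A c = {x \<in> V. A x = c *\<^sub>R x}"

definition linear_isometry ::
    "'a::real_vector set \<Rightarrow> 'a form \<Rightarrow> 'b::real_vector set \<Rightarrow> 'b form \<Rightarrow> ('a \<Rightarrow> 'b) \<Rightarrow> bool" where
  "linear_isometry V h V' h' Q \<longleftrightarrow>
     lin_map V V' Q \<and> bij_betw Q V V' \<and> (\<forall>x\<in>V. \<forall>y\<in>V. h' (Q x) (Q y) = h x y)"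


section \<open>Lie algebras\<close>

type_synonym 'a bracket = "'a \<Rightarrow> 'a \<Rightarrow> 'a"

definition lie_algebra :: "'a::real_vector set \<Rightarrow> 'a bracket \<Rightarrow> bool" where
  "lie_algebra V br \<longleftrightarrow> finite_dim_space V
     \<and> (\<forall>x\<in>V. lin_map V V (br x)) \<and> (\<forall>y\<in>V. lin_map V V (\<lambda>x. br x y))
     \<and> (\<forall>x\<in>V. br x x = 0)
     \<and> (\<forall>x\<in>V. \<forall>y\<in>V. \<forall>z\<in>V. br x (br y z) + br y (br z x) + br z (br x y) = 0)"

definition lie_subalgebra :: "'a::real_vector set \<Rightarrow> 'a bracket \<Rightarrow> 'a set \<Rightarrow> bool" where
  "lie_subalgebra V br W \<longleftrightarrow> subspace W \<and> W \<subseteq> V \<and> (\<forall>x\<in>W. \<forall>y\<in>W. br x y \<in> W)"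

definition lie_isomorphism :: "'a::real_vector set \<Rightarrow> 'a bracket \<Rightarrow>
    'b::real_vector set \<Rightarrow> 'b bracket \<Rightarrow> ('a \<Rightarrow> 'b) \<Rightarrow> bool" where
  "lie_isomorphism V br V' br' F \<longleftrightarrow> lie_algebra V br \<and> lie_algebra V' br'
     \<and> lin_map V V' F \<and> bij_betw F V V' \<and> (\<forall>x\<in>V. \<forall>y\<in>V. F (br x y) = br' (F x) (F y))"

definition lie_isomorphic :: "'a::real_vector set \<Rightarrow> 'a bracket \<Rightarrow>
    'b::real_vector set \<Rightarrow> 'b bracket \<Rightarrow> bool" where
  "lie_isomorphic V br V' br' \<longleftrightarrow> (\<exists>F. lie_isomorphism V br V' br' F)"

definition lie_representation :: "'a::real_vector set \<Rightarrow> 'a bracket \<Rightarrow>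
    'b::real_vector set \<Rightarrow> ('a \<Rightarrow> 'b \<Rightarrow> 'b) \<Rightarrow> bool" where
  "lie_representation L br W r \<longleftrightarrow> lie_algebra L br \<and> finite_dim_space W
     \<and> (\<forall>x\<in>L. lin_map W W (r x)) \<and> (\<forall>w\<in>W. lin_map L W (\<lambda>x. r x w))
     \<and> (\<forall>x\<in>L. \<forall>y\<in>L. \<forall>w\<in>W. r (br x y) w = r x (r y w) - r y (r x w))"

definition ce_closed :: "'a set \<Rightarrow> 'a bracket \<Rightarrow> 'a form \<Rightarrow> bool" where
  "ce_closed V br w \<longleftrightarrow>
     (\<forall>x\<in>V. \<forall>y\<in>V. \<forall>z\<in>V. - w (br x y) z + w (br x z) y - w (br y z) x = 0)"

definition nijenhuis :: "'a::real_vector bracket \<Rightarrow> ('a \<Rightarrow> 'a) \<Rightarrow> 'a bracket" where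
  "nijenhuis br J x y = br (J x) (J y) - J (br (J x) y) - J (br x (J y)) + J (J (br x y))"


section \<open>Born structures\<close>

text \<open>A triple \<open>(g, h, w)\<close>; the almost complex structure is minus the operator from \<open>w\<close> to \<open>h\<close>.\<close>

type_synonym 'a born = "'a form \<times> 'a form \<times> 'a form"

fun born_A :: "'a::real_vector set \<Rightarrow> 'a born \<Rightarrow> 'a \<Rightarrow> 'a" where
  "born_A V (g, h, w) = recursion_operator V g w"

fun born_B :: "'a::real_vector set \<Rightarrow> 'a born \<Rightarrow> 'a \<Rightarrow> 'a" where
  "born_B V (g, h, w) = recursion_operator V g h"

fun born_J :: "'a::real_vector set \<Rightarrow> 'a born \<Rightarrow> 'a \<Rightarrow> 'a" where
  "born_J V (g, h, w) = (\<lambda>x. - recursion_operator V w h x)"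

fun born_structure :: "'a::real_vector set \<Rightarrow> 'a born \<Rightarrow> bool" where
  "born_structure V (g, h, w) \<longleftrightarrow>
     pseudo_riemannian V g \<and> pseudo_riemannian V h \<and> nondegenerate_two_form V w
     \<and> (\<forall>x\<in>V. born_A V (g, h, w) (born_A V (g, h, w) x) = x)
     \<and> (\<forall>x\<in>V. born_B V (g, h, w) (born_B V (g, h, w) x) = x)
     \<and> (\<forall>x\<in>V. born_J V (g, h, w) (born_J V (g, h, w) x) = - x)"

fun integrable_born_structure :: "'a::real_vector set \<Rightarrow> 'a bracket \<Rightarrow> 'a born \<Rightarrow> bool" where
  "integrable_born_structure V br (g, h, w) \<longleftrightarrow>
     born_structure V (g, h, w)
     \<and> ce_closed V br w
     \<and> (\<forall>x\<in>V. \<forall>y\<in>V. nijenhuis br (born_J V (g, h, w)) x y = 0)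
     \<and> lie_subalgebra V br (eigenspace V (born_A V (g, h, w)) 1)
     \<and> lie_subalgebra V br (eigenspace V (born_A V (g, h, w)) (- 1))"

definition born_lie_algebra :: "'a::real_vector set \<Rightarrow> 'a bracket \<Rightarrow> bool" where
  "born_lie_algebra V br \<longleftrightarrow> lie_algebra V br \<and> (\<exists>S. integrable_born_structure V br S)"

fun born_equivalent :: "'a::real_vector set \<Rightarrow> 'a bracket \<Rightarrow> 'a born \<Rightarrow>
    'b::real_vector set \<Rightarrow> 'b bracket \<Rightarrow> 'b born \<Rightarrow> bool" where
  "born_equivalent V br (g, h, w) V' br' (g', h', w') \<longleftrightarrow>
     born_structure V (g, h, w) \<and> born_structure V' (g', h', w')
     \<and> (\<exists>F. lie_isomorphism V br V' br' F
          \<and> (\<forall>x\<in>V. \<forall>y\<in>V. h' (F x) (F y) = h x y)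
          \<and> (\<forall>x\<in>V. \<forall>y\<in>V. g' (F x) (F y) = g x y)
          \<and> (\<forall>x\<in>V. \<forall>y\<in>V. w' (F x) (F y) = w x y))"


subsection \<open>The encoding by a metric, a complex structure and a splitting\<close>

definition direct_sum :: "'a::real_vector set \<Rightarrow> 'a set \<Rightarrow> 'a set \<Rightarrow> bool" where
  "direct_sum V Vp Vm \<longleftrightarrow> subspace Vp \<and> subspace Vm
     \<and> V = {u + v | u v. u \<in> Vp \<and> v \<in> Vm} \<and> Vp \<inter> Vm = {0}"

definition born_encoding :: "'a::real_vector set \<Rightarrow> 'a form \<Rightarrow> ('a \<Rightarrow> 'a) \<Rightarrow>
    'a set \<Rightarrow> 'a set \<Rightarrow> bool" where
  "born_encoding V h J Vp Vm \<longleftrightarrow> pseudo_riemannian V h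
     \<and> lin_map V V J \<and> (\<forall>x\<in>V. J (J x) = - x) \<and> (\<forall>x\<in>V. \<forall>y\<in>V. h (J x) (J y) = h x y)
     \<and> direct_sum V Vp Vm \<and> (\<forall>x\<in>Vp. \<forall>y\<in>Vm. h x y = 0)
     \<and> J ` Vp = Vm \<and> J ` Vm = Vp"

text \<open>The involution with eigenspaces \<open>Vp\<close> (for \<open>1\<close>) and \<open>Vm\<close> (for \<open>-1\<close>).\<close>

definition splitting_involution :: "'a::real_vector set \<Rightarrow> 'a set \<Rightarrow> 'a \<Rightarrow> 'a" where
  "splitting_involution Vp Vm x = (THE z. \<exists>u\<in>Vp. \<exists>v\<in>Vm. x = u + v \<and> z = u - v)"

definition born_of_encoding :: "'a::real_vector form \<Rightarrow> ('a \<Rightarrow> 'a) \<Rightarrow> 'a set \<Rightarrow> 'a set \<Rightarrow> 'a born" where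
  "born_of_encoding h J Vp Vm =
     ((\<lambda>x y. h (J (splitting_involution Vp Vm x)) y), h, (\<lambda>x y. h (J x) y))"


section \<open>Bicross products\<close>

text \<open>The external direct sum of \<open>Vp\<close> and \<open>Vm\<close> is carried by \<open>Vp \<times> Vm\<close>.\<close>

definition bicross_compatible :: "'a::real_vector set \<Rightarrow> 'a bracket \<Rightarrow>
    'b::real_vector set \<Rightarrow> 'b bracket \<Rightarrow> ('b \<Rightarrow> 'a \<Rightarrow> 'a) \<Rightarrow> ('a \<Rightarrow> 'b \<Rightarrow> 'b) \<Rightarrow> bool" where
  "bicross_compatible Vp brp Vm brm \<phi> \<rho> \<longleftrightarrow>
     (\<forall>xp\<in>Vp. \<forall>yp\<in>Vp. \<forall>xm\<in>Vm.
        \<phi> xm (brp xp yp) - brp (\<phi> xm xp) yp - brp xp (\<phi> xm yp)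
          + \<phi> (\<rho> xp xm) yp - \<phi> (\<rho> yp xm) xp = 0)
     \<and> (\<forall>xm\<in>Vm. \<forall>ym\<in>Vm. \<forall>xp\<in>Vp.
        \<rho> xp (brm xm ym) - brm (\<rho> xp xm) ym - brm xm (\<rho> xp ym)
          + \<rho> (\<phi> xm xp) ym - \<rho> (\<phi> ym xp) xm = 0)"

fun bicross_bracket :: "'a::real_vector bracket \<Rightarrow> 'b::real_vector bracket \<Rightarrow>
    ('b \<Rightarrow> 'a \<Rightarrow> 'a) \<Rightarrow> ('a \<Rightarrow> 'b \<Rightarrow> 'b) \<Rightarrow> ('a \<times> 'b) bracket" where
  "bicross_bracket brp brm \<phi> \<rho> (xp, xm) (yp, ym) =
     (brp xp yp + \<phi> xm yp - \<phi> ym xp, brm xm ym + \<rho> xp ym - \<rho> yp xm)"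

fun sum_form :: "'a form \<Rightarrow> 'b form \<Rightarrow> ('a \<times> 'b) form" where
  "sum_form hp hm (xp, xm) (yp, ym) = hp xp yp + hm xm ym"

definition J_of_isometry :: "'a::real_vector set \<Rightarrow> ('a \<Rightarrow> 'b::real_vector) \<Rightarrow> 'a \<times> 'b \<Rightarrow> 'a \<times> 'b" where
  "J_of_isometry Vp Q = (\<lambda>(xp, xm). (- the_inv_into Vp Q xm, Q xp))"

text \<open>
  \<open>\<phi>\<close> and \<open>\<rho>\<close> enter an associated Born structure only through the bracket on \<open>Vp \<times> Vm\<close>.
\<close>

definition associated_born :: "'a::real_vector set \<Rightarrow> 'a form \<Rightarrow>
    'b::real_vector set \<Rightarrow> 'b form \<Rightarrow> ('a \<Rightarrow> 'b) \<Rightarrow> ('a \<times> 'b) born" where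
  "associated_born Vp hp Vm hm Q =
     born_of_encoding (sum_form hp hm) (J_of_isometry Vp Q) (Vp \<times> {0}) ({0} \<times> Vm)"


section \<open>Recursion operators are well defined\<close>

lemma lin_map_mem: "lin_map V W f \<Longrightarrow> x \<in> V \<Longrightarrow> f x \<in> W"
  and lin_map_add: "lin_map V W f \<Longrightarrow> x \<in> V \<Longrightarrow> y \<in> V \<Longrightarrow> f (x + y) = f x + f y"
  and lin_map_scale: "lin_map V W f \<Longrightarrow> x \<in> V \<Longrightarrow> f (c *\<^sub>R x) = c *\<^sub>R f x"
  by (auto simp: lin_map_def)

lemma lin_map_neg: "lin_map V W f \<Longrightarrow> x \<in> V \<Longrightarrow> f (- x) = - f x"
  using lin_map_scale[of V W f x "-1"] by simp

lemma lin_map_diff: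
  assumes "lin_map V W f" "subspace V" "x \<in> V" "y \<in> V" shows "f (x - y) = f x - f y"
  using assms lin_map_add[of V W f x "- y"] by (simp add: lin_map_neg subspace_neg)

lemma form_simps:
  assumes "bilinear_form V a" "subspace V" "x \<in> V" "y \<in> V" "z \<in> V"
  shows "a (x + y) z = a x z + a y z" "a (x - y) z = a x z - a y z" "a (- x) z = - a x z"
    "a (c *\<^sub>R x) z = c * a x z"
    "a z (x + y) = a z x + a z y" "a z (x - y) = a z x - a z y" "a z (- x) = - a z x"
    "a z (c *\<^sub>R x) = c * a z x"
proof -
  have l: "lin_map V UNIV (\<lambda>x. a x z)" and r: "lin_map V UNIV (a z)"
    using assms by (auto simp: bilinear_form_def)
  show "a (x + y) z = a x z + a y z" "a (x - y) z = a x z - a y z" "a (- x) z = - a x z"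
    "a (c *\<^sub>R x) z = c * a x z"
    using lin_map_add[OF l] lin_map_diff[OF l] lin_map_neg[OF l] lin_map_scale[OF l] assms by auto
  show "a z (x + y) = a z x + a z y" "a z (x - y) = a z x - a z y" "a z (- x) = - a z x"
    "a z (c *\<^sub>R x) = c * a z x"
    using lin_map_add[OF r] lin_map_diff[OF r] lin_map_neg[OF r] lin_map_scale[OF r] assms by auto
qed

lemma nondegenerate_eqI:
  assumes "bilinear_form V a" "subspace V" "nondegenerate V a" "x \<in> V" "y \<in> V"
    and "\<And>z. z \<in> V \<Longrightarrow> a x z = a y z"
  shows "x = y"
proof -
  have "x - y \<in> V" using assms by (simp add: subspace_diff)
  moreover have "\<forall>z\<in>V. a (x - y) z = 0" using assms form_simps(2)[OF assms(1,2)] by simp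
  ultimately show ?thesis using assms(3) unfolding nondegenerate_def by fastforce
qed

lemma recursion_operator_eqI:
  assumes "bilinear_form V a" "subspace V" "nondegenerate V a" and A: "is_recursion_operator V a b A"
  shows "is_recursion_operator V a b (recursion_operator V a b)"
    and "x \<in> V \<Longrightarrow> recursion_operator V a b x = A x"
proof -
  have bij: "bij_betw (restrict A V) V V"
    using A by (auto simp: is_recursion_operator_def cong: bij_betw_cong)
  have R: "is_recursion_operator V a b (restrict A V)"
    using A bij \<open>subspace V\<close>
    by (auto simp: is_recursion_operator_def lin_map_def subspace_add subspace_scale)
  have "recursion_operator V a b = restrict A V"
    unfolding recursion_operator_def
  proof (rule the_equality)
    show "restrict A V \<in> extensional V \<and> is_recursion_operator V a b (restrict A V)"
      using R by simp
  next
    fix C assume C: "C \<in> extensional V \<and> is_recursion_operator V a b C"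
    show "C = restrict A V"
    proof (rule extensionalityI[of _ V])
      fix x assume x: "x \<in> V"
      show "C x = restrict A V x"
        by (rule nondegenerate_eqI[OF assms(1-3)])
          (use x C A in \<open>auto simp: is_recursion_operator_def lin_map_mem\<close>)
    qed (use C in auto)
  qed
  then show "is_recursion_operator V a b (recursion_operator V a b)"
    and "x \<in> V \<Longrightarrow> recursion_operator V a b x = A x"
    using R by auto
qed

lemma finite_dim_basis:
  assumes "finite_dim_space V"
  obtains B where "finite B" "independent B" "span B = V"
proof -
  have sub: "subspace V" using assms by (simp add: finite_dim_space_def)
  obtain C where C: "finite C" "span C = V" using assms by (auto simp: finite_dim_space_def)
  obtain B where B: "B \<subseteq> V" "independent B" "V \<subseteq> span B"
    using maximal_independent_subset by blast
  have "span B = V" using B sub by (simp add: span_minimal subset_antisym)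
  moreover have "finite B" using independent_span_bound[OF C(1) B(2)] B(1) C(2) by auto
  ultimately show thesis using that B by blast
qed

lemma lin_map_inj_bij:
  assumes V: "finite_dim_space V" and f: "lin_map V V f" and ker: "\<And>x. x \<in> V \<Longrightarrow> f x = 0 \<Longrightarrow> x = 0"
  shows "bij_betw f V V"
proof -
  have sub: "subspace V" using V by (simp add: finite_dim_space_def)
  obtain B where finB: "finite B" and B: "independent B" and spB: "span B = V"
    using finite_dim_basis[OF V] by blast
  obtain F where F: "linear F" "\<forall>x\<in>B. F x = f x"
    using linear_independent_extend[OF B] by blast
  have f0: "f 0 = 0" using lin_map_scale[OF f, of 0 0] sub by (simp add: subspace_0)
  have Ff: "F x = f x" if "x \<in> V" for x
  proof -
    have "x \<in> span B" using that spB by simp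
    moreover have "subspace {x \<in> V. F x = f x}"
      using sub f F(1) f0
      by (auto simp: subspace_def linear_add linear_scale lin_map_add lin_map_scale linear_0)
    moreover have "e \<in> {x \<in> V. F x = f x}" if "e \<in> B" for e
      using that F(2) spB span_base by blast
    ultimately have "x \<in> {x \<in> V. F x = f x}" by (metis (no_types, lifting) span_minimal subsetI subsetD)
    then show ?thesis by simp
  qed
  have inj: "inj_on F (span B)"
  proof (rule inj_onI)
    fix x y assume xy: "x \<in> span B" "y \<in> span B" "F x = F y"
    then have m: "x - y \<in> V" using spB sub by (simp add: subspace_diff)
    have "f (x - y) = 0" using Ff[OF m] F(1) xy(3) by (simp add: linear_diff)
    then show "x = y" using ker[OF m] by simp
  qed
  have BV: "B \<subseteq> V" using spB span_superset by blast
  have FB: "F ` B \<subseteq> V"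
    using BV Ff lin_map_mem[OF f] by auto
  have ind: "independent (F ` B)"
    using linear_independent_injective_image[OF F(1) B inj] .
  have cd: "card (F ` B) = card B"
    using inj by (meson card_image inj_on_subset span_superset)
  have "V \<subseteq> span (F ` B)"
  proof (rule ccontr)
    assume "\<not> V \<subseteq> span (F ` B)"
    then obtain v where v: "v \<in> V" "v \<notin> span (F ` B)" by blast
    then have "independent (insert v (F ` B))" using ind by (simp add: independent_insertI)
    then have "card (insert v (F ` B)) \<le> card B"
      using independent_span_bound[OF finB, of "insert v (F ` B)"] FB v spB by auto
    moreover have "v \<notin> F ` B" using v span_superset by blast
    ultimately show False using cd finB by simp
  qed
  moreover have "span (F ` B) = F ` V" using linear_span_image[OF F(1), of B] spB by simp
  moreover have "F ` V \<subseteq> V" using Ff lin_map_mem[OF f] by auto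
  ultimately have "F ` V = V" by blast
  then have "bij_betw F V V" using inj spB by (simp add: bij_betw_def)
  then show ?thesis using Ff bij_betw_cong[of V F f V] by simp
qed

lemma recursion_operator_ex:
  assumes V: "finite_dim_space V" and a: "bilinear_form V a" "nondegenerate V a"
    and b: "bilinear_form V b" "nondegenerate V b"
  shows "is_recursion_operator V a b (recursion_operator V a b)"
proof -
  have sub: "subspace V" using V by (simp add: finite_dim_space_def)
  obtain B where B: "finite B" "independent B" "span B = V"
    using finite_dim_basis[OF V] by blast
  have BV: "e \<in> V" if "e \<in> B" for e using B that span_base by blast
  define I where "I c x = (\<Sum>e\<in>B. c x e *\<^sub>R e)" for c :: "'a form" and x
  have coeff: "\<forall>e\<in>B. r e = s e" if "(\<Sum>e\<in>B. r e *\<^sub>R e) = (\<Sum>e\<in>B. s e *\<^sub>R e)" for r s :: "'a \<Rightarrow> real"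
  proof -
    have "(\<Sum>e\<in>B. (r e - s e) *\<^sub>R e) = 0"
      using that by (simp add: scaleR_diff_left sum_subtractf)
    then show ?thesis using independentD[OF B(2,1) subset_refl] by fastforce
  qed
  have ext: "\<forall>y\<in>V. c x y = d z y"
    if cd: "bilinear_form V c" "bilinear_form V d" and xz: "x \<in> V" "z \<in> V"
      and e: "\<forall>e\<in>B. c x e = d z e" for c d x z
  proof -
    have "subspace {y \<in> V. c x y = d z y}"
      unfolding subspace_def
      using form_simps(5,8)[OF cd(1) sub _ _ xz(1)] form_simps(5,8)[OF cd(2) sub _ _ xz(2)]
        form_simps(8)[OF cd(1) sub _ _ xz(1), of 0 0 0] form_simps(8)[OF cd(2) sub _ _ xz(2), of 0 0 0]
        sub[unfolded subspace_def]
      by auto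
    moreover have "B \<subseteq> {y \<in> V. c x y = d z y}" using e BV by auto
    ultimately show ?thesis using span_minimal B(3) by blast
  qed
  have bijI: "lin_map V V (I c) \<and> bij_betw (I c) V V" if c: "bilinear_form V c" "nondegenerate V c" for c
  proof -
    have lin: "lin_map V V (I c)"
      unfolding lin_map_def
    proof (intro conjI ballI allI funcsetI)
      fix x y :: 'a and r :: real assume x: "x \<in> V"
      show "I c x \<in> V" unfolding I_def using sub BV by (auto intro!: subspace_sum subspace_scale)
      show "I c (r *\<^sub>R x) = r *\<^sub>R I c x"
        unfolding I_def scaleR_sum_right
        using form_simps(4)[OF c(1) sub x x] BV by (intro sum.cong) auto
      assume y: "y \<in> V"
      show "I c (x + y) = I c x + I c y"
        unfolding I_def sum.distrib[symmetric]
        using form_simps(1)[OF c(1) sub x y] BV by (intro sum.cong) (auto simp: scaleR_add_left)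
    qed
    have "x = 0" if x: "x \<in> V" "I c x = 0" for x
    proof -
      have "\<forall>e\<in>B. c x e = 0" using coeff[of "c x" "\<lambda>_. 0"] x(2) by (simp add: I_def)
      moreover have "c 0 y = 0" if "y \<in> V" for y
        using form_simps(4)[OF c(1) sub _ _ that, of 0 0 0] subspace_0[OF sub] by simp
      ultimately have "\<forall>y\<in>V. c x y = c 0 y"
        using ext[OF c(1) c(1) x(1) subspace_0[OF sub]] BV by simp
      then show ?thesis
        using nondegenerate_eqI[OF c(1) sub c(2) x(1) subspace_0[OF sub]] by simp
    qed
    then show ?thesis using lin_map_inj_bij[OF V lin] lin by blast
  qed
  note Ia = bijI[OF a] and Ib = bijI[OF b]
  define A where "A x = inv_into V (I a) (I b x)" for x
  have AV: "A x \<in> V" and IA: "I a (A x) = I b x" if "x \<in> V" for x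
  proof -
    have "I b x \<in> I a ` V" using that Ia Ib by (auto simp: bij_betw_def lin_map_mem)
    then show "A x \<in> V" "I a (A x) = I b x"
      unfolding A_def by (simp_all add: inv_into_into f_inv_into_f)
  qed
  have eq: "\<forall>y\<in>V. a (A x) y = b x y" if x: "x \<in> V" for x
    using ext[OF a(1) b(1) AV[OF x] x] coeff[of "a (A x)" "b x"] IA[OF x] by (simp add: I_def)
  have lin: "lin_map V V A"
    unfolding lin_map_def
  proof (intro conjI ballI allI funcsetI)
    fix x y :: 'a and r :: real assume x: "x \<in> V"
    note rx = subspace_scale[OF sub x, of r]
    show "A x \<in> V" using AV[OF x] .
    show "A (r *\<^sub>R x) = r *\<^sub>R A x"
    proof (rule nondegenerate_eqI[OF a(1) sub a(2) AV[OF rx] subspace_scale[OF sub AV[OF x]]])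
      fix z assume z: "z \<in> V"
      show "a (A (r *\<^sub>R x)) z = a (r *\<^sub>R A x) z"
        using eq[OF rx] eq[OF x] z form_simps(4)[OF a(1) sub AV[OF x] z z]
          form_simps(4)[OF b(1) sub x z z] by simp
    qed
    assume y: "y \<in> V"
    note xy = subspace_add[OF sub x y]
    show "A (x + y) = A x + A y"
    proof (rule nondegenerate_eqI[OF a(1) sub a(2) AV[OF xy] subspace_add[OF sub AV[OF x] AV[OF y]]])
      fix z assume z: "z \<in> V"
      show "a (A (x + y)) z = a (A x + A y) z"
        using eq[OF xy] eq[OF x] eq[OF y] z form_simps(1)[OF a(1) sub AV[OF x] AV[OF y] z]
          form_simps(1)[OF b(1) sub x y z] by simp
    qed
  qed
  have "bij_betw (inv_into V (I a) \<circ> I b) V V"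
    using Ia Ib by (intro bij_betw_trans[of _ _ V]) (auto simp: bij_betw_inv_into)
  moreover have "inv_into V (I a) \<circ> I b = A" by (simp add: fun_eq_iff A_def)
  ultimately have "bij_betw A V V" by simp
  with lin eq have "is_recursion_operator V a b A" by (simp add: is_recursion_operator_def)
  then show ?thesis using recursion_operator_eqI(1)[OF a(1) sub a(2)] by blast
qed


section \<open>Born structures correspond to their encodings\<close>

lemma splitting_involution_eq:
  assumes "direct_sum V Vp Vm" "u \<in> Vp" "v \<in> Vm"
  shows "splitting_involution Vp Vm (u + v) = u - v"
  unfolding splitting_involution_def
proof (rule the_equality)
  show "\<exists>u'\<in>Vp. \<exists>v'\<in>Vm. u + v = u' + v' \<and> u - v = u' - v'" using assms by blast
next
  fix z assume "\<exists>u'\<in>Vp. \<exists>v'\<in>Vm. u + v = u' + v' \<and> z = u' - v'"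
  then obtain u' v' where uv: "u' \<in> Vp" "v' \<in> Vm" "u + v = u' + v'" "z = u' - v'" by blast
  have "u - u' = v' - v" using uv(3) by (simp add: algebra_simps)
  moreover have "u - u' \<in> Vp" "v' - v \<in> Vm"
    using assms uv by (auto simp: direct_sum_def subspace_diff)
  ultimately have "u - u' \<in> Vp \<inter> Vm" by simp
  then have "u - u' = 0" using assms unfolding direct_sum_def by blast
  then have "u = u'" by simp
  then show "z = u - v" using uv by simp
qed

theorem born_of_encoding:
  assumes sub: "subspace V" and enc: "born_encoding V h J Vp Vm"
  defines "S \<equiv> born_of_encoding h J Vp Vm"
  shows "born_structure V S"
    and "x \<in> V \<Longrightarrow> born_J V S x = J x"
    and "eigenspace V (born_A V S) 1 = Vp"
    and "eigenspace V (born_A V S) (- 1) = Vm"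
proof -
  define A where "A = splitting_involution Vp Vm"
  define w where "w = (\<lambda>x y. h (J x) y)"
  define g where "g = (\<lambda>x y. h (J (A x)) y)"
  have S: "S = (g, h, w)" by (simp add: S_def born_of_encoding_def g_def w_def A_def)
  have h: "bilinear_form V h" "nondegenerate V h" and hsym: "\<And>x y. x \<in> V \<Longrightarrow> y \<in> V \<Longrightarrow> h x y = h y x"
    and J: "lin_map V V J" and JJ: "\<And>x. x \<in> V \<Longrightarrow> J (J x) = - x"
    and hJ: "\<And>x y. x \<in> V \<Longrightarrow> y \<in> V \<Longrightarrow> h (J x) (J y) = h x y"
    and ds: "direct_sum V Vp Vm" and orth: "\<And>x y. x \<in> Vp \<Longrightarrow> y \<in> Vm \<Longrightarrow> h x y = 0"
    and Jpm: "\<And>x. x \<in> Vp \<Longrightarrow> J x \<in> Vm" and Jmp: "\<And>x. x \<in> Vm \<Longrightarrow> J x \<in> Vp"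
    using enc by (auto simp: born_encoding_def pseudo_riemannian_def)
  note JV = lin_map_mem[OF J]
  have sp: "subspace Vp" "subspace Vm" and pV: "\<And>x. x \<in> Vp \<Longrightarrow> x \<in> V" and mV: "\<And>x. x \<in> Vm \<Longrightarrow> x \<in> V"
    and dec: "\<And>x. x \<in> V \<Longrightarrow> \<exists>u\<in>Vp. \<exists>v\<in>Vm. x = u + v" and int: "Vp \<inter> Vm = {0}"
    using ds unfolding direct_sum_def by (auto, metis add_0_right subspace_0, metis add_0 subspace_0)
  have Auv: "A (u + v) = u - v" if "u \<in> Vp" "v \<in> Vm" for u v
    using splitting_involution_eq[OF ds that] by (simp add: A_def)
  have AV: "A x \<in> V" and AA: "A (A x) = x" and AJ: "A (J x) = - J (A x)" if x: "x \<in> V" for x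
  proof -
    obtain u v where uv: "u \<in> Vp" "v \<in> Vm" "x = u + v" using dec[OF x] by blast
    have m: "- v \<in> Vm" using uv sp by (simp add: subspace_neg)
    show "A x \<in> V" using Auv uv pV mV sub by (simp add: subspace_diff)
    show "A (A x) = x" using Auv[OF uv(1) m] Auv uv by simp
    have "J x = J v + J u" using uv lin_map_add[OF J] pV mV by (simp add: add.commute)
    then have "A (J x) = J v - J u" using Auv uv Jpm Jmp by simp
    also have "\<dots> = - J (A x)" using Auv uv lin_map_diff[OF J sub] pV mV by simp
    finally show "A (J x) = - J (A x)" .
  qed
  have A: "lin_map V V A"
    unfolding lin_map_def
  proof (intro conjI ballI allI funcsetI)
    fix x y c assume x: "x \<in> V"
    obtain u v where uv: "u \<in> Vp" "v \<in> Vm" "x = u + v" using dec[OF x] by blast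
    show "A x \<in> V" using AV[OF x] .
    have "c *\<^sub>R u \<in> Vp" "c *\<^sub>R v \<in> Vm" using uv sp by (auto simp: subspace_scale)
    from Auv[OF this] show "A (c *\<^sub>R x) = c *\<^sub>R A x"
      using Auv uv by (simp add: scaleR_add_right scaleR_diff_right)
    assume y: "y \<in> V"
    obtain u' v' where uv': "u' \<in> Vp" "v' \<in> Vm" "y = u' + v'" using dec[OF y] by blast
    have "u + u' \<in> Vp" "v + v' \<in> Vm" using uv uv' sp by (auto simp: subspace_add)
    from Auv[OF this] have "A ((u + u') + (v + v')) = (u - v) + (u' - v')" by simp
    moreover have "x + y = (u + u') + (v + v')" using uv uv' by simp
    ultimately have "A (x + y) = (u - v) + (u' - v')" by simp
    also have "\<dots> = A x + A y" using Auv[OF uv(1,2)] Auv[OF uv'(1,2)] uv uv' by simp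
    finally show "A (x + y) = A x + A y" .
  qed
  have hA: "h (A x) y = h x (A y)" if x: "x \<in> V" and y: "y \<in> V" for x y
  proof -
    obtain u v where uv: "u \<in> Vp" "v \<in> Vm" "x = u + v" using dec[OF x] by blast
    obtain u' v' where uv': "u' \<in> Vp" "v' \<in> Vm" "y = u' + v'" using dec[OF y] by blast
    have "h v u' = 0" using orth[OF uv'(1) uv(2)] hsym uv uv' pV mV by simp
    then show ?thesis
      using uv uv' Auv form_simps[OF h(1) sub] pV mV orth sub by (simp add: subspace_add subspace_diff)
  qed
  have hJ': "h (J x) y = - h x (J y)" if "x \<in> V" "y \<in> V" for x y
    using hJ[OF that(1) JV[OF that(2)]] JJ[OF that(2)]
      form_simps(7)[OF h(1) sub that(2) that(2) JV[OF that(1)]] by simp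
  have comp: "bilinear_form V (\<lambda>x y. h (f x) y)" if f: "lin_map V V f" for f
    unfolding bilinear_form_def
  proof (intro conjI ballI)
    fix x assume "x \<in> V"
    then show "lin_map V UNIV (\<lambda>y. h (f x) y)"
      using h(1) lin_map_mem[OF f] by (simp add: bilinear_form_def)
  next
    fix y assume "y \<in> V"
    then show "lin_map V UNIV (\<lambda>x. h (f x) y)"
      using f form_simps[OF h(1) sub lin_map_mem[OF f] lin_map_mem[OF f]]
      by (simp add: lin_map_def)
  qed
  have nd: "nondegenerate V (\<lambda>x y. h (f x) y)"
    if "lin_map V V f" "\<And>x. x \<in> V \<Longrightarrow> f x = 0 \<Longrightarrow> x = 0" for f
    using h(2) that lin_map_mem[OF that(1)] unfolding nondegenerate_def by blast
  have z: "f 0 = 0" if "lin_map V V f" for f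
    using lin_map_scale[OF that subspace_0[OF sub], of 0] by simp
  have JA: "lin_map V V (\<lambda>x. J (A x))"
    using A J by (auto simp: lin_map_def Pi_iff)
  have A0: "x = 0" if "x \<in> V" "A x = 0" for x using AA[OF that(1)] that(2) z[OF A] by simp
  have J0: "x = 0" if "x \<in> V" "J x = 0" for x using JJ[OF that(1)] that(2) z[OF J] by simp
  have w: "bilinear_form V w" "nondegenerate V w" using comp[OF J] nd[OF J] J0 by (auto simp: w_def)
  have wsk: "w x y = - w y x" if "x \<in> V" "y \<in> V" for x y
    using hJ'[OF that] hsym[OF that(1) JV[OF that(2)]] by (simp add: w_def)
  have g: "bilinear_form V g" "nondegenerate V g"
    using comp[OF JA] nd[OF JA] J0 A0 AV by (auto simp: g_def)
  have gsym: "g x y = g y x" if "x \<in> V" "y \<in> V" for x y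
    unfolding g_def
    using hJ'[OF AV[OF that(1)] that(2)] hA[OF that(1) JV[OF that(2)]] AJ[OF that(2)]
      form_simps(7)[OF h(1) sub JV[OF AV[OF that(2)]] that(1) that(1)]
      hsym[OF that(1) JV[OF AV[OF that(2)]]] by simp
  have bij: "bij_betw f V V" if "f \<in> V \<rightarrow> V" "k \<in> V \<rightarrow> V" "\<And>x. x \<in> V \<Longrightarrow> k (f x) = x" "\<And>x. x \<in> V \<Longrightarrow> f (k x) = x" for f k :: "'a \<Rightarrow> 'a"
    using that by (intro bij_betw_byWitness[where f' = k]) auto
  have rA: "is_recursion_operator V g w A"
    unfolding is_recursion_operator_def
    using A AV AA bij[of A A] by (auto simp: g_def w_def)
  have negV: "- x \<in> V" if "x \<in> V" for x using that sub by (simp add: subspace_neg)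
  define nJ where "nJ = (\<lambda>x. - J x)"
  have nJ: "lin_map V V nJ"
    using J negV by (auto simp: lin_map_def nJ_def)
  have rJ: "is_recursion_operator V w h nJ"
    unfolding is_recursion_operator_def
  proof (intro conjI ballI nJ)
    show "bij_betw nJ V V"
      by (rule bij[of _ J]) (use lin_map_mem[OF nJ] JJ lin_map_neg[OF J] JV in \<open>auto simp: nJ_def\<close>)
    fix x y assume "x \<in> V" "y \<in> V"
    then show "w (nJ x) y = h x y" using JJ lin_map_neg[OF J] JV by (simp add: w_def nJ_def)
  qed
  define C where "C = (\<lambda>x. - A (J x))"
  have C: "lin_map V V C" using A J negV by (auto simp: lin_map_def C_def Pi_iff)
  have CC: "C (C x) = x" if x: "x \<in> V" for x
  proof -
    have "C x = J (A x)" using AJ[OF x] by (simp add: C_def)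
    then have "C (C x) = - A (J (J (A x)))" by (simp add: C_def)
    also have "\<dots> = x" using JJ[OF AV[OF x]] lin_map_neg[OF A AV[OF x]] AA[OF x] by simp
    finally show ?thesis .
  qed
  have rB: "is_recursion_operator V g h C"
    unfolding is_recursion_operator_def
  proof (intro conjI ballI C)
    show "bij_betw C V V" by (rule bij[of _ C]) (use C CC in \<open>auto simp: lin_map_mem\<close>)
    fix x y assume x: "x \<in> V" and y: "y \<in> V"
    have "J (A (C x)) = x"
      using lin_map_neg[OF A AV[OF JV[OF x]]] AA[OF JV[OF x]] lin_map_neg[OF J JV[OF x]] JJ[OF x]
      by (simp add: C_def)
    then show "g (C x) y = h x y" by (simp add: g_def)
  qed
  have eA: "recursion_operator V g w x = A x" and eB: "recursion_operator V g h x = C x"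
    and eJ: "recursion_operator V w h x = - J x" if "x \<in> V" for x
    using recursion_operator_eqI(2)[OF g(1) sub g(2) rA that]
      recursion_operator_eqI(2)[OF g(1) sub g(2) rB that]
      recursion_operator_eqI(2)[OF w(1) sub w(2) rJ that] by (auto simp: nJ_def)
  have metrics: "pseudo_riemannian V g" "pseudo_riemannian V h" "nondegenerate_two_form V w"
    unfolding pseudo_riemannian_def nondegenerate_two_form_def
    using h g w hsym gsym wsk by blast+
  then show "born_structure V S"
    using eA eB eJ AV AA CC lin_map_mem[OF C] JV JJ by (simp add: S)
  show "born_J V S x = J x" if "x \<in> V" using eJ[OF that] by (simp add: S)
  have "A x = x \<longleftrightarrow> x \<in> Vp" and "A x = - x \<longleftrightarrow> x \<in> Vm" if x: "x \<in> V" for x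
  proof -
    obtain u v where uv: "u \<in> Vp" "v \<in> Vm" "x = u + v" using dec[OF x] by blast
    have Ax: "A x = u - v" using Auv uv by simp
    have dbl: "t = 0" if "t + t = 0" for t :: 'a
      using that by (metis scaleR_2 scaleR_eq_0_iff zero_neq_numeral)
    show "A x = x \<longleftrightarrow> x \<in> Vp"
    proof
      assume "A x = x"
      then have "v + v = 0" using Ax uv(3) by (simp add: algebra_simps)
      then have "v = 0" by (rule dbl)
      then show "x \<in> Vp" using uv by simp
    next
      assume "x \<in> Vp"
      then show "A x = x" using Auv[of x 0] sp by (simp add: subspace_0)
    qed
    show "A x = - x \<longleftrightarrow> x \<in> Vm"
    proof
      assume "A x = - x"
      then have "u - v + (u + v) = 0" using Ax uv(3) by (metis add.left_inverse)
      moreover have "u + u = (u - v) + (u + v)" by simp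
      ultimately have "u + u = 0" by metis
      then have "u = 0" by (rule dbl)
      then show "x \<in> Vm" using uv by simp
    next
      assume "x \<in> Vm"
      then show "A x = - x" using Auv[of 0 x] sp by (simp add: subspace_0)
    qed
  qed
  then show "eigenspace V (born_A V S) 1 = Vp" "eigenspace V (born_A V S) (- 1) = Vm"
    using eA pV mV by (auto simp: S eigenspace_def)
qed

theorem encoding_of_born:
  assumes V: "finite_dim_space V" and born: "born_structure V S" and S: "S = (g, h, w)"
  defines "J \<equiv> born_J V S"
    and "Vp \<equiv> eigenspace V (born_A V S) 1" and "Vm \<equiv> eigenspace V (born_A V S) (- 1)"
  shows "born_encoding V h J Vp Vm"
    and "\<forall>x\<in>V. \<forall>y\<in>V. fst (born_of_encoding h J Vp Vm) x y = g x y"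
    and "\<forall>x\<in>V. \<forall>y\<in>V. snd (snd (born_of_encoding h J Vp Vm)) x y = w x y"
proof -
  have sub: "subspace V" using V by (simp add: finite_dim_space_def)
  define A B K where "A = recursion_operator V g w" and "B = recursion_operator V g h"
    and "K = recursion_operator V w h"
  have h: "bilinear_form V h" "nondegenerate V h" and hsym: "\<And>x y. x \<in> V \<Longrightarrow> y \<in> V \<Longrightarrow> h x y = h y x"
    and g: "bilinear_form V g" "nondegenerate V g" and gsym: "\<And>x y. x \<in> V \<Longrightarrow> y \<in> V \<Longrightarrow> g x y = g y x"
    and w: "bilinear_form V w" "nondegenerate V w" and wsk: "\<And>x y. x \<in> V \<Longrightarrow> y \<in> V \<Longrightarrow> w x y = - w y x"
    and AA: "\<And>x. x \<in> V \<Longrightarrow> A (A x) = x" and BB: "\<And>x. x \<in> V \<Longrightarrow> B (B x) = x"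
    and JJ: "\<And>x. x \<in> V \<Longrightarrow> J (J x) = - x"
    using born
    unfolding S J_def A_def B_def born_structure.simps born_A.simps born_B.simps
      pseudo_riemannian_def nondegenerate_two_form_def
    by blast+
  have Jx: "J x = - K x" for x by (simp add: J_def K_def S)
  have A: "lin_map V V A" and gA: "\<And>x y. x \<in> V \<Longrightarrow> y \<in> V \<Longrightarrow> g (A x) y = w x y"
    using recursion_operator_ex[OF V g w] by (auto simp: A_def is_recursion_operator_def)
  have B: "lin_map V V B" and gB: "\<And>x y. x \<in> V \<Longrightarrow> y \<in> V \<Longrightarrow> g (B x) y = h x y"
    using recursion_operator_ex[OF V g h] by (auto simp: B_def is_recursion_operator_def)
  have K: "lin_map V V K" and wK: "\<And>x y. x \<in> V \<Longrightarrow> y \<in> V \<Longrightarrow> w (K x) y = h x y"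
    using recursion_operator_ex[OF V w h] by (auto simp: K_def is_recursion_operator_def)
  note AV = lin_map_mem[OF A] and BV = lin_map_mem[OF B] and KV = lin_map_mem[OF K]
  have JV: "J x \<in> V" if "x \<in> V" for x using KV[OF that] sub by (simp add: Jx subspace_neg)
  have J: "lin_map V V J"
    using K JV by (auto simp: lin_map_def Jx)
  have KK: "K (K x) = - x" if "x \<in> V" for x
    using JJ[OF that] lin_map_neg[OF K KV[OF that]] by (simp add: Jx)
  have BAK: "B x = A (K x)" if x: "x \<in> V" for x
    by (rule nondegenerate_eqI[OF g(1) sub g(2) BV[OF x] AV[OF KV[OF x]]])
      (use gA gB wK KV x in auto)
  have AKAK: "A (K (A (K x))) = x" if "x \<in> V" for x
    using BB[OF that] BAK[OF that] BAK[OF AV[OF KV[OF that]]] by simp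
  have KA: "K (A x) = - A (K x)" if x: "x \<in> V" for x
  proof -
    have "A (K (A (K (K x)))) = K x" using AKAK[OF KV[OF x]] .
    then have "A (A (K (A (- x)))) = A (K x)" using KK[OF x] by simp
    then have "K (A (- x)) = A (K x)"
      using AA[OF KV[OF AV[OF subspace_neg[OF sub x]]]] by simp
    then have "- K (A x) = A (K x)" using lin_map_neg[OF A x] lin_map_neg[OF K AV[OF x]] by simp
    then show ?thesis by (metis minus_minus)
  qed
  have JA: "J (A x) = - A (J x)" if x: "x \<in> V" for x
    using KA[OF x] lin_map_neg[OF A KV[OF x]] by (simp add: Jx)
  have w_h: "h (J x) y = w x y" if x: "x \<in> V" and y: "y \<in> V" for x y
    using wK[OF JV[OF x] y] lin_map_neg[OF K KV[OF x]] KK[OF x] by (simp add: Jx)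
  have hJJ: "h (J x) (J y) = h x y" if x: "x \<in> V" and y: "y \<in> V" for x y
  proof -
    have "h (J x) (J y) = - w (J y) x" using w_h[OF x JV[OF y]] wsk[OF x JV[OF y]] by simp
    also have "\<dots> = w (K y) x"
      using form_simps(3)[OF w(1) sub KV[OF y] x x] by (simp add: Jx)
    finally show ?thesis using wK[OF y x] hsym[OF x y] by simp
  qed
  have g_w: "w (A x) y = g x y" if "x \<in> V" "y \<in> V" for x y
    using gA[OF AV[OF that(1)] that(2)] AA[OF that(1)] by simp
  have wA: "w (A x) y = - w x (A y)" if "x \<in> V" "y \<in> V" for x y
    using g_w[OF that] g_w[OF that(2,1)] gsym[OF that] wsk[OF AV[OF that(2)] that(1)] by simp
  have hA: "h (A x) y = h x (A y)" if x: "x \<in> V" and y: "y \<in> V" for x y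
  proof -
    have "h (A x) y = w (K (A x)) y" using wK[OF AV[OF x] y] by simp
    also have "\<dots> = - w (A (K x)) y"
      using KA[OF x] form_simps(3)[OF w(1) sub AV[OF KV[OF x]] y y] by simp
    also have "\<dots> = h x (A y)" using wA[OF KV[OF x] y] wK[OF x AV[OF y]] by simp
    finally show ?thesis .
  qed
  have Vp: "Vp = {x \<in> V. A x = x}" and Vm: "Vm = {x \<in> V. A x = - x}"
    by (auto simp: Vp_def Vm_def eigenspace_def A_def S)
  have z: "A 0 = 0" using lin_map_scale[OF A subspace_0[OF sub], of 0] by simp
  have halves: "t = (1/2) *\<^sub>R (t + s) + (1/2) *\<^sub>R (t - s)" for t s :: 'a
  proof -
    have "(1/2) *\<^sub>R (t + s) + (1/2) *\<^sub>R (t - s) = (1/2) *\<^sub>R t + (1/2) *\<^sub>R t"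
      by (simp add: scaleR_add_right scaleR_diff_right del: scaleR_half_double)
    also have "\<dots> = (1/2 + 1/2) *\<^sub>R t" by (rule scaleR_add_left[symmetric])
    finally show ?thesis by simp
  qed
  have self_neg: "t = 0" if "t = - t" for t :: 'a
    using that by (metis add.right_inverse scaleR_2 scaleR_eq_0_iff zero_neq_numeral)
  have ds: "direct_sum V Vp Vm"
    unfolding direct_sum_def
  proof (intro conjI)
    show "subspace Vp" "subspace Vm"
      using sub A z unfolding Vp Vm subspace_def by (auto simp: lin_map_add lin_map_scale)
    show "Vp \<inter> Vm = {0}" using z subspace_0[OF sub] self_neg unfolding Vp Vm by fastforce
    show "V = {u + v |u v. u \<in> Vp \<and> v \<in> Vm}"
    proof (intro subset_antisym subsetI)
      fix x assume x: "x \<in> V"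
      let ?u = "(1/2) *\<^sub>R (x + A x)" and ?v = "(1/2) *\<^sub>R (x - A x)"
      have s: "x + A x \<in> V" and d: "x - A x \<in> V"
        using sub x AV by (auto simp: subspace_add subspace_diff)
      have "A ?u = ?u" using lin_map_scale[OF A s] lin_map_add[OF A x AV[OF x]] AA[OF x]
        by (simp add: add.commute)
      moreover have "A ?v = - ?v"
        using lin_map_scale[OF A d] lin_map_diff[OF A sub x AV[OF x]] AA[OF x]
        by (simp add: scaleR_diff_right)
      moreover have "x = ?u + ?v" by (rule halves)
      moreover have "?u \<in> V" "?v \<in> V" using s d sub by (auto simp: subspace_scale)
      ultimately show "x \<in> {u + v |u v. u \<in> Vp \<and> v \<in> Vm}" unfolding Vp Vm by blast
    qed (use sub in \<open>auto simp: Vp Vm subspace_add\<close>)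
  qed
  have orth: "h x y = 0" if "x \<in> Vp" "y \<in> Vm" for x y
  proof -
    have "x \<in> V" "y \<in> V" "A x = x" "A y = - y" using that by (auto simp: Vp Vm)
    then show ?thesis using hA[of x y] form_simps(7)[OF h(1) sub, of y y x] by simp
  qed
  have pm: "J x \<in> Vm" if "x \<in> Vp" for x
  proof -
    have "x \<in> V" "A x = x" using that by (auto simp: Vp)
    moreover from this have "A (J x) = - J x" using JA[of x] by (metis minus_minus)
    ultimately show ?thesis using JV by (simp add: Vm)
  qed
  have mp: "J x \<in> Vp" if "x \<in> Vm" for x
  proof -
    have "x \<in> V" "A x = - x" using that by (auto simp: Vm)
    moreover from this have "A (J x) = J x" using JA[of x] lin_map_neg[OF J, of x] by (metis minus_minus)
    ultimately show ?thesis using JV by (simp add: Vp)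
  qed
  have surj: "x \<in> J ` W'" if "x \<in> W" "W \<subseteq> V" "subspace W'" "\<And>y. y \<in> W \<Longrightarrow> J y \<in> W'" for x W W'
  proof
    have "x \<in> V" using that by blast
    then show "x = J (- J x)" using lin_map_neg[OF J JV] JJ by simp
    show "- J x \<in> W'" using that by (simp add: subspace_neg)
  qed
  have im: "J ` Vp = Vm" "J ` Vm = Vp"
    using pm mp surj[of _ Vm Vp] surj[of _ Vp Vm] ds by (auto simp: direct_sum_def Vp Vm)
  show "born_encoding V h J Vp Vm"
    unfolding born_encoding_def pseudo_riemannian_def
    using h hsym J JJ hJJ ds orth im by auto
  have inv: "splitting_involution Vp Vm x = A x" if x: "x \<in> V" for x
  proof -
    obtain u v where uv: "u \<in> Vp" "v \<in> Vm" "x = u + v"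
      using x ds unfolding direct_sum_def by blast
    then have "A x = u - v" using lin_map_add[OF A, of u v] by (auto simp: Vp Vm)
    then show ?thesis using splitting_involution_eq[OF ds uv(1,2)] uv(3) by simp
  qed
  show "\<forall>x\<in>V. \<forall>y\<in>V. fst (born_of_encoding h J Vp Vm) x y = g x y"
    using inv w_h g_w AV by (simp add: born_of_encoding_def)
  show "\<forall>x\<in>V. \<forall>y\<in>V. snd (snd (born_of_encoding h J Vp Vm)) x y = w x y"
    using w_h by (simp add: born_of_encoding_def)
qed

end

theory Submission
  imports Defs
begin

text \<open>
  Integrability makes both summands of \<open>V = Vp \<oplus> Vm\<close> subalgebras, so the bracket of \<open>V\<close> is known from
  its restrictions to the summands together with the mixed brackets. For \<open>x \<in> Vm\<close> and \<open>u \<in> Vp\<close> split the mixed bracket as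
  \<open>br x u = \<phi> x u - \<rho> u x\<close> with \<open>\<phi> x u \<in> Vp\<close> and \<open>\<rho> u x \<in> Vm\<close>. In other words, \<open>\<phi>\<close> is the action of
  \<open>Vm\<close> on \<open>V / Vm \<cong> Vp\<close> induced by the adjoint representation, and \<open>\<rho>\<close> is the action of \<open>Vp\<close> on
  \<open>V / Vp \<cong> Vm\<close>. The Jacobi identity for two elements of one summand and one element of the other
  has a component in each summand: one component says that an action is a representation
  (\<open>representation\<close>), the other is one of the bicross conditions (\<open>compatible\<close>). The map
  \<open>F x = (x\<^sub>+, x\<^sub>-)\<close> turns the bracket of \<open>V\<close> into the bicross bracket (\<open>component_bracket\<close>).

  The isometry is \<open>Q = J\<close> on \<open>Vp\<close>. Since \<open>J\<close> interchanges the summands and squares to \<open>-1\<close>, its inverse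
  \<open>Vm \<rightarrow> Vp\<close> is \<open>-J\<close>, so that \<open>J\<^sub>Q \<circ> F = F \<circ> J\<close>; orthogonality of the summands says that \<open>F\<close> carries \<open>h\<close>
  to the sum form. Everything on \<open>Vp \<times> Vm\<close> that needs proof, namely that it is a Lie algebra and
  that its Born data are a Born structure, is then transported from \<open>V\<close> along \<open>F\<close> (\<open>lie_algebra_image\<close>,
  \<open>born_encoding_image\<close>), rather than checked again on pairs.
\<close>


section \<open>Transport along linear isomorphisms\<close>

lemma lin_map_zero: "lin_map V W f \<Longrightarrow> subspace V \<Longrightarrow> f 0 = 0"
  using lin_map_scale[of V W f 0 0] by (simp add: subspace_0)

lemma subspace_lin_map_image:
  assumes f: "lin_map V W f" and U: "subspace U" "U \<subseteq> V"
  shows "subspace (f ` U)"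
  unfolding subspace_def
proof (intro conjI ballI allI)
  have "0 \<in> V" using U subspace_0 by blast
  then have "f 0 = 0" using lin_map_scale[OF f, of 0 0] by simp
  then show "0 \<in> f ` U" using U by (metis image_eqI subspace_0)
next
  fix x y assume "x \<in> f ` U" "y \<in> f ` U"
  then obtain a b where ab: "a \<in> U" "b \<in> U" "x = f a" "y = f b" by blast
  then have "x + y = f (a + b)" using lin_map_add[OF f] U by (simp add: subset_iff)
  then show "x + y \<in> f ` U" using ab U by (auto simp: subspace_add)
next
  fix c x assume "x \<in> f ` U"
  then obtain a where a: "a \<in> U" "x = f a" by blast
  then have "c *\<^sub>R x = f (c *\<^sub>R a)" using lin_map_scale[OF f] U by (simp add: subset_iff)
  then show "c *\<^sub>R x \<in> f ` U" using a U by (auto simp: subspace_scale)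
qed

lemma finite_dim_space_image:
  assumes V: "finite_dim_space V" and f: "lin_map V W f" and onto: "f ` V = W"
  shows "finite_dim_space W"
proof -
  obtain B where B: "finite B" "span B = V" and sub: "subspace V"
    using V by (auto simp: finite_dim_space_def)
  have W: "subspace W" using subspace_lin_map_image[OF f sub] onto by simp
  have BV: "B \<subseteq> V" using B span_superset by blast
  \<comment> \<open>The map is linear on \<open>V\<close> only, so the span of the image is computed by induction over \<open>span B\<close>.\<close>
  have "subspace {x \<in> V. f x \<in> span (f ` B)}"
    using sub lin_map_zero[OF f sub] lin_map_add[OF f] lin_map_scale[OF f]
    by (auto simp: subspace_def span_zero span_add span_scale)
  moreover have "B \<subseteq> {x \<in> V. f x \<in> span (f ` B)}" using BV by (auto simp: span_base)
  ultimately have "V \<subseteq> {x \<in> V. f x \<in> span (f ` B)}" using B span_minimal by blast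
  then have "W \<subseteq> span (f ` B)" using onto by blast
  moreover have "span (f ` B) \<subseteq> W" using BV onto W by (intro span_minimal) auto
  ultimately show ?thesis using W B(1) unfolding finite_dim_space_def by blast
qed

lemma lie_algebra_image:
  assumes L: "lie_algebra V br" and F: "lin_map V V' F" and onto: "F ` V = V'"
    and hom: "\<And>x y. x \<in> V \<Longrightarrow> y \<in> V \<Longrightarrow> F (br x y) = br' (F x) (F y)"
  shows "lie_algebra V' br'"
proof -
  have fin: "finite_dim_space V" and r: "\<And>x. x \<in> V \<Longrightarrow> lin_map V V (br x)"
    and l: "\<And>y. y \<in> V \<Longrightarrow> lin_map V V (\<lambda>x. br x y)"
    and alt: "\<And>x. x \<in> V \<Longrightarrow> br x x = 0"
    and jac: "\<And>x y z. x \<in> V \<Longrightarrow> y \<in> V \<Longrightarrow> z \<in> V \<Longrightarrow> br x (br y z) + br y (br z x) + br z (br x y) = 0"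
    using L by (auto simp: lie_algebra_def)
  have sub: "subspace V" using fin by (simp add: finite_dim_space_def)
  have cl: "br x y \<in> V" if "x \<in> V" "y \<in> V" for x y using lin_map_mem[OF r] that by blast
  note F0 = lin_map_zero[OF F sub]
  note Fa = lin_map_add[OF F] and Fs = lin_map_scale[OF F] and FV = lin_map_mem[OF F]
  note ra = lin_map_add[OF r] and rs = lin_map_scale[OF r]
  note la = lin_map_add[OF l] and ls = lin_map_scale[OF l]
  note V = subspace_add[OF sub] subspace_scale[OF sub]
  have "lin_map V' V' (br' x)" "lin_map V' V' (\<lambda>y. br' y x)" "br' x x = 0" if x: "x \<in> V'" for x
  proof -
    obtain a where a: "a \<in> V" "x = F a" using x onto by blast
    show "br' x x = 0" using hom[OF a(1) a(1)] alt[OF a(1)] F0 a by simp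
    have add: "br' x (y + z) = br' x y + br' x z" "br' (y + z) x = br' y x + br' z x"
      if yz: "y \<in> V'" "z \<in> V'" for y z
    proof -
      obtain b c where bc: "b \<in> V" "y = F b" "c \<in> V" "z = F c" using yz onto by blast
      show "br' x (y + z) = br' x y + br' x z"
        using hom[OF a(1) V(1)[OF bc(1,3)]] ra[OF a(1) bc(1,3)] Fa[OF bc(1,3)] a bc
        by (simp add: hom Fa cl)
      show "br' (y + z) x = br' y x + br' z x"
        using hom[OF V(1)[OF bc(1,3)] a(1)] la[OF a(1) bc(1,3)] Fa[OF bc(1,3)] a bc
        by (simp add: hom Fa cl)
    qed
    have scale: "br' x (c *\<^sub>R y) = c *\<^sub>R br' x y" "br' (c *\<^sub>R y) x = c *\<^sub>R br' y x"
      and mem: "br' x y \<in> V'" "br' y x \<in> V'" if y: "y \<in> V'" for c y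
    proof -
      obtain b where b: "b \<in> V" "y = F b" using y onto by blast
      show "br' x (c *\<^sub>R y) = c *\<^sub>R br' x y"
        using hom[OF a(1) V(2)[OF b(1)], of c] rs[OF a(1) b(1), of c] Fs[OF b(1), of c] a b
        by (simp add: hom Fs cl)
      show "br' (c *\<^sub>R y) x = c *\<^sub>R br' y x"
        using hom[OF V(2)[OF b(1)] a(1), of c] ls[OF a(1) b(1), of c] Fs[OF b(1), of c] a b
        by (simp add: hom Fs cl)
      show "br' x y \<in> V'" "br' y x \<in> V'"
        using FV[OF cl[OF a(1) b(1)]] FV[OF cl[OF b(1) a(1)]] hom a b by simp_all
    qed
    show "lin_map V' V' (br' x)" "lin_map V' V' (\<lambda>y. br' y x)"
      using add scale mem by (auto simp: lin_map_def)
  qed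
  moreover have "br' x (br' y z) + br' y (br' z x) + br' z (br' x y) = 0"
    if xyz: "x \<in> V'" "y \<in> V'" "z \<in> V'" for x y z
  proof -
    obtain a b c where abc: "a \<in> V" "x = F a" "b \<in> V" "y = F b" "c \<in> V" "z = F c"
      using xyz onto by blast
    have "F (br a (br b c) + br b (br c a) + br c (br a b)) = 0" using jac F0 abc by simp
    then show ?thesis using abc by (simp add: hom Fa cl V)
  qed
  ultimately show ?thesis
    using finite_dim_space_image[OF fin F onto] by (simp add: lie_algebra_def)
qed

lemma pseudo_riemannian_image:
  assumes h: "pseudo_riemannian V h" and sub: "subspace V"
    and F: "lin_map V V' F" and onto: "F ` V = V'"
    and iso: "\<And>x y. x \<in> V \<Longrightarrow> y \<in> V \<Longrightarrow> h' (F x) (F y) = h x y"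
  shows "pseudo_riemannian V' h'"
proof -
  have bil: "bilinear_form V h" and nd: "nondegenerate V h"
    and sym: "\<And>x y. x \<in> V \<Longrightarrow> y \<in> V \<Longrightarrow> h x y = h y x"
    using h by (auto simp: pseudo_riemannian_def)
  have sym': "h' x y = h' y x" if "x \<in> V'" "y \<in> V'" for x y
    using that iso sym onto by (metis imageE)
  have lin: "lin_map V' UNIV (h' x)" if x: "x \<in> V'" for x
    unfolding lin_map_def
  proof (intro conjI ballI allI funcsetI UNIV_I)
    obtain a where a: "a \<in> V" "x = F a" using x onto by blast
    fix y assume "y \<in> V'"
    then obtain b where b: "b \<in> V" "y = F b" using onto by blast
    show "h' x (c *\<^sub>R y) = c *\<^sub>R h' x y" for c
      using iso[OF a(1) subspace_scale[OF sub b(1)], of c] form_simps(8)[OF bil sub b(1) b(1) a(1), of c]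
        lin_map_scale[OF F b(1), of c] iso[OF a(1) b(1)] a b by simp
    fix z assume "z \<in> V'"
    then obtain c where c: "c \<in> V" "z = F c" using onto by blast
    show "h' x (y + z) = h' x y + h' x z"
      using iso[OF a(1) subspace_add[OF sub b(1) c(1)]] form_simps(5)[OF bil sub b(1) c(1) a(1)]
        lin_map_add[OF F b(1) c(1)] iso[OF a(1)] a b c by simp
  qed
  have sub': "subspace V'" using subspace_lin_map_image[OF F sub] onto by simp
  have "lin_map V' UNIV (\<lambda>x. h' x y)" if y: "y \<in> V'" for y
    using lin[OF y] sym'[OF _ y] subspace_add[OF sub'] subspace_scale[OF sub']
    by (simp add: lin_map_def)
  moreover have "x = 0" if x: "x \<in> V'" "\<forall>y\<in>V'. h' x y = 0" for x
  proof -
    obtain a where a: "a \<in> V" "x = F a" using x onto by blast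
    have "\<forall>b\<in>V. h a b = 0" using x(2) a iso onto by auto
    then have "a = 0" using nd a by (auto simp: nondegenerate_def)
    then show ?thesis using a lin_map_zero[OF F sub] by simp
  qed
  ultimately show ?thesis
    using lin sym' by (auto simp: pseudo_riemannian_def bilinear_form_def nondegenerate_def)
qed

lemma direct_sum_image:
  assumes ds: "direct_sum V U W" and F: "lin_map V V' F" and bij: "bij_betw F V V'"
  shows "direct_sum V' (F ` U) (F ` W)"
proof -
  have s: "subspace U" "subspace W" and V: "V = {u + v | u v. u \<in> U \<and> v \<in> W}" and int: "U \<inter> W = {0}"
    using ds by (auto simp: direct_sum_def)
  have UV: "U \<subseteq> V" "W \<subseteq> V"
    unfolding V using subspace_0[OF s(1)] subspace_0[OF s(2)] by force+
  have inj: "inj_on F V" and onto: "F ` V = V'" using bij by (auto simp: bij_betw_def)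
  have "F 0 = 0" using lin_map_scale[OF F, of 0 0] UV subspace_0[OF s(1)] by auto
  then have "F ` U \<inter> F ` W = {0}"
    using inj_on_image_Int[OF inj UV] int by simp
  moreover have "V' = {u + v | u v. u \<in> F ` U \<and> v \<in> F ` W}"
  proof -
    have "F (u + v) = F u + F v" if "u \<in> U" "v \<in> W" for u v
      using lin_map_add[OF F] that UV by blast
    then show ?thesis unfolding onto[symmetric] V by (force simp: image_iff)
  qed
  ultimately show ?thesis
    using subspace_lin_map_image[OF F s(1) UV(1)] subspace_lin_map_image[OF F s(2) UV(2)]
    by (simp add: direct_sum_def)
qed

lemma born_encoding_image:
  assumes enc: "born_encoding V h J Vp Vm" and sub: "subspace V"
    and F: "lin_map V V' F" and bij: "bij_betw F V V'"
    and iso: "\<And>x y. x \<in> V \<Longrightarrow> y \<in> V \<Longrightarrow> h' (F x) (F y) = h x y"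
    and FJ: "\<And>x. x \<in> V \<Longrightarrow> J' (F x) = F (J x)"
  shows "born_encoding V' h' J' (F ` Vp) (F ` Vm)"
proof -
  have h: "pseudo_riemannian V h" and J: "lin_map V V J" and JJ: "\<And>x. x \<in> V \<Longrightarrow> J (J x) = - x"
    and hJ: "\<And>x y. x \<in> V \<Longrightarrow> y \<in> V \<Longrightarrow> h (J x) (J y) = h x y"
    and ds: "direct_sum V Vp Vm" and orth: "\<And>x y. x \<in> Vp \<Longrightarrow> y \<in> Vm \<Longrightarrow> h x y = 0"
    and Jim: "J ` Vp = Vm" "J ` Vm = Vp"
    using enc by (auto simp: born_encoding_def)
  have onto: "V' = F ` V" using bij by (simp add: bij_betw_def)
  note JV = lin_map_mem[OF J]
  have PV: "x \<in> V" if "x \<in> Vp \<or> x \<in> Vm" for x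
    using ds that subspace_0 unfolding direct_sum_def by force
  have "lin_map V' V' J'"
    unfolding lin_map_def onto
    using subspace_add[OF sub] subspace_scale[OF sub]
    by (auto simp: FJ JV lin_map_add[OF J] lin_map_scale[OF J]
        lin_map_add[OF F, symmetric] lin_map_scale[OF F, symmetric])
  moreover have "\<forall>x\<in>V'. J' (J' x) = - x"
    unfolding onto by (auto simp: FJ JV JJ lin_map_neg[OF F])
  moreover have "\<forall>x\<in>V'. \<forall>y\<in>V'. h' (J' x) (J' y) = h' x y"
    unfolding onto by (auto simp: FJ JV hJ iso)
  moreover have "\<forall>x\<in>F ` Vp. \<forall>y\<in>F ` Vm. h' x y = 0" by (auto simp: iso PV orth)
  moreover have "J' ` F ` Vp = F ` J ` Vp" "J' ` F ` Vm = F ` J ` Vm"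
    using FJ PV by (auto simp: image_image)
  ultimately show ?thesis
    using pseudo_riemannian_image[OF h sub F onto[symmetric] iso] direct_sum_image[OF ds F bij] Jim
    by (simp add: born_encoding_def)
qed

lemma splitting_involution_image:
  assumes ds: "direct_sum V U W" and F: "lin_map V V' F" and bij: "bij_betw F V V'"
    and sub: "subspace V" and x: "x \<in> V"
  shows "splitting_involution U W x \<in> V"
    and "splitting_involution (F ` U) (F ` W) (F x) = F (splitting_involution U W x)"
proof -
  obtain u v where uv: "u \<in> U" "v \<in> W" "x = u + v" using ds x by (auto simp: direct_sum_def)
  have V: "u \<in> V" "v \<in> V" using ds uv subspace_0 unfolding direct_sum_def by force+
  show "splitting_involution U W x \<in> V"
    using splitting_involution_eq[OF ds uv(1,2)] uv V sub by (simp add: subspace_diff)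
  show "splitting_involution (F ` U) (F ` W) (F x) = F (splitting_involution U W x)"
    using splitting_involution_eq[OF direct_sum_image[OF ds F bij], of "F u" "F v"]
      splitting_involution_eq[OF ds uv(1,2)] lin_map_add[OF F V] lin_map_diff[OF F sub V] uv
    by simp
qed


section \<open>Components of a direct sum\<close>

definition component :: "'a::real_vector set \<Rightarrow> 'a set \<Rightarrow> 'a \<Rightarrow> 'a" where
  "component U W x = (THE u. u \<in> U \<and> x - u \<in> W)"

lemma direct_sum_sym: "direct_sum V U W \<Longrightarrow> direct_sum V W U"
  unfolding direct_sum_def by (auto simp: Int_commute) (metis add.commute)+

lemma component_add:
  assumes ds: "direct_sum V U W" and u: "u \<in> U" and w: "w \<in> W"
  shows "component U W (u + w) = u"
  unfolding component_def
proof (rule the_equality)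
  show "u \<in> U \<and> u + w - u \<in> W" using u w by simp
  fix v assume v: "v \<in> U \<and> u + w - v \<in> W"
  have "u - v \<in> U" using ds u v by (simp add: direct_sum_def subspace_diff)
  moreover have "u - v = (u + w - v) - w" by simp
  then have "u - v \<in> W" using ds v w by (metis direct_sum_def subspace_diff)
  ultimately have "u - v = 0" using ds unfolding direct_sum_def by blast
  then show "v = u" by (simp only: right_minus_eq)
qed

lemma component_split:
  assumes ds: "direct_sum V U W" and x: "x \<in> V"
  shows "component U W x \<in> U" "component U W x + component W U x = x"
proof -
  obtain u w where uw: "u \<in> U" "w \<in> W" "x = u + w" using ds x by (auto simp: direct_sum_def)
  then have "component U W x = u" "component W U x = w"
    using component_add[OF ds uw(1,2)] component_add[OF direct_sum_sym[OF ds] uw(2,1)]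
    by (simp_all add: add.commute)
  then show "component U W x \<in> U" "component U W x + component W U x = x" using uw by simp_all
qed

lemma direct_sum_subset:
  assumes "direct_sum V U W" shows "U \<subseteq> V" "W \<subseteq> V"
  using assms subspace_0 unfolding direct_sum_def by force+

lemma component_same: "direct_sum V U W \<Longrightarrow> u \<in> U \<Longrightarrow> component U W u = u"
  using component_add[of V U W u 0] by (simp add: direct_sum_def subspace_0)

lemma component_other: "direct_sum V U W \<Longrightarrow> w \<in> W \<Longrightarrow> component U W w = 0"
  using component_add[of V U W 0 w] by (simp add: direct_sum_def subspace_0)

lemma component_lin_map:
  assumes ds: "direct_sum V U W"
  shows "lin_map V U (component U W)"
  unfolding lin_map_def
proof (intro conjI ballI allI funcsetI)
  let ?P = "component U W" and ?M = "component W U"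
  note P = component_split[OF ds] and M = component_split(1)[OF direct_sum_sym[OF ds]]
  have s: "subspace U" "subspace W" using ds by (auto simp: direct_sum_def)
  fix x assume x: "x \<in> V"
  show "?P x \<in> U" using P(1)[OF x] .
  show "?P (c *\<^sub>R x) = c *\<^sub>R ?P x" for c
  proof -
    have "c *\<^sub>R x = c *\<^sub>R ?P x + c *\<^sub>R ?M x" using P(2)[OF x] by (metis scaleR_add_right)
    then show ?thesis
      using component_add[OF ds, of "c *\<^sub>R ?P x" "c *\<^sub>R ?M x"] P(1)[OF x] M[OF x] s
      by (simp add: subspace_scale)
  qed
  fix y assume y: "y \<in> V"
  have "x + y = (?P x + ?P y) + (?M x + ?M y)" using P(2)[OF x] P(2)[OF y] by (simp add: algebra_simps)
  then show "?P (x + y) = ?P x + ?P y"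
    using component_add[OF ds, of "?P x + ?P y" "?M x + ?M y"] P(1)[OF x] M[OF x] P(1)[OF y] M[OF y] s
    by (simp add: subspace_add)
qed

lemma components_bij:
  assumes ds: "direct_sum V U W"
  shows "lin_map V (U \<times> W) (\<lambda>x. (component U W x, component W U x))" (is "lin_map V _ ?F")
    and "bij_betw (\<lambda>x. (component U W x, component W U x)) V (U \<times> W)"
    and "(\<lambda>x. (component U W x, component W U x)) ` U = U \<times> {0}"
    and "(\<lambda>x. (component U W x, component W U x)) ` W = {0} \<times> W"
proof -
  note ds' = direct_sum_sym[OF ds]
  show "lin_map V (U \<times> W) ?F"
    using component_lin_map[OF ds] component_lin_map[OF ds'] by (auto simp: lin_map_def)
  have F: "?F (u + w) = (u, w)" if "u \<in> U" "w \<in> W" for u w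
    using component_add[OF ds that] component_add[OF ds' that(2,1)] by (simp add: add.commute)
  have "u + w \<in> V" if "u \<in> U" "w \<in> W" for u w using ds that by (auto simp: direct_sum_def)
  then show "bij_betw ?F V (U \<times> W)"
    using component_split[OF ds] component_split(1)[OF ds'] F
    by (intro bij_betw_byWitness[where f' = "\<lambda>(u, w). u + w"]) auto
  show "?F ` U = U \<times> {0}" "?F ` W = {0} \<times> W"
    using component_same[OF ds] component_same[OF ds'] component_other[OF ds] component_other[OF ds']
    by (auto simp: image_iff)
qed


section \<open>Lie algebras split into two subalgebras\<close>

locale lie_splitting =
  fixes V :: "'a::real_vector set" and br :: "'a bracket" and U W :: "'a set"
  assumes lie: "lie_algebra V br" and split: "direct_sum V U W"
    and subU: "lie_subalgebra V br U" and subW: "lie_subalgebra V br W"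
begin

text \<open>
  The two summands play symmetric roles, so each fact below is proved for one of them and read for
  the other through this swap.
\<close>

lemma swapped: "lie_splitting V br W U"
  using lie direct_sum_sym[OF split] subU subW by unfold_locales

abbreviation "P \<equiv> component U W"
abbreviation "M \<equiv> component W U"

text \<open>The action of \<open>W\<close> on \<open>U\<close>, where \<open>U\<close> stands for the quotient \<open>V / W\<close>.\<close>

abbreviation "act w u \<equiv> P (br w u)"

lemma subsp: "subspace V" "subspace U" "subspace W"
  using lie split by (auto simp: lie_algebra_def finite_dim_space_def direct_sum_def)

lemma mem_V: "u \<in> U \<Longrightarrow> u \<in> V" "w \<in> W \<Longrightarrow> w \<in> V"
  using direct_sum_subset[OF split] by auto

lemma bracket_lin:
  assumes "x \<in> V"
  shows "lin_map V V (br x)" "lin_map V V (\<lambda>y. br y x)"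
  using lie assms by (auto simp: lie_algebra_def)

lemma bracket_mem: "x \<in> V \<Longrightarrow> y \<in> V \<Longrightarrow> br x y \<in> V"
  using lin_map_mem[OF bracket_lin(1)] by blast

lemma bracket_mem_sub: "x \<in> U \<Longrightarrow> y \<in> U \<Longrightarrow> br x y \<in> U" "x \<in> W \<Longrightarrow> y \<in> W \<Longrightarrow> br x y \<in> W"
  using subU subW by (auto simp: lie_subalgebra_def)

lemma bracket_simps:
  assumes "x \<in> V" "y \<in> V" "z \<in> V"
  shows "br x (y + z) = br x y + br x z" "br (y + z) x = br y x + br z x"
  using lin_map_add[OF bracket_lin(1)] lin_map_add[OF bracket_lin(2)] assms by blast+

lemma bracket_skew:
  assumes x: "x \<in> V" and y: "y \<in> V"
  shows "br x y = - br y x"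
proof -
  have s: "br z z = 0" if "z \<in> V" for z using lie that by (auto simp: lie_algebra_def)
  have "br (x + y) (x + y) = br x x + br y x + (br x y + br y y)"
    using bracket_simps[OF _ x y] bracket_simps[OF x x y] bracket_simps[OF y x y]
      subspace_add[OF subsp(1) x y] by simp
  then have "br x y + br y x = 0" using s x y subspace_add[OF subsp(1)] by (simp add: add.commute)
  then show ?thesis by (simp add: eq_neg_iff_add_eq_0)
qed

lemma bracket_derivation:
  assumes x: "x \<in> V" and y: "y \<in> V" and z: "z \<in> V"
  shows "br x (br y z) = br (br x y) z + br y (br x z)"
proof -
  have "br x (br y z) + br y (br z x) + br z (br x y) = 0"
    using lie assms by (auto simp: lie_algebra_def)
  moreover have "br y (br z x) = - br y (br x z)"
    using bracket_skew[OF z x] lin_map_neg[OF bracket_lin(1)[OF y] bracket_mem[OF x z]] by simp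
  moreover have "br z (br x y) = - br (br x y) z" by (rule bracket_skew[OF z bracket_mem[OF x y]])
  ultimately show ?thesis by (simp add: algebra_simps)
qed

lemma P_simps:
  assumes "x \<in> V" "y \<in> V"
  shows "P (x + y) = P x + P y" "P (x - y) = P x - P y" "P (- x) = - P x"
  using lin_map_add[OF component_lin_map[OF split]] lin_map_neg[OF component_lin_map[OF split]]
    lin_map_diff[OF component_lin_map[OF split] subsp(1)] assms
  by auto

lemma P_mem: "x \<in> V \<Longrightarrow> P x \<in> U" and M_mem: "x \<in> V \<Longrightarrow> M x \<in> W"
  using component_split(1)[OF split] component_split(1)[OF direct_sum_sym[OF split]] by auto

lemma P_sub: "u \<in> U \<Longrightarrow> P u = u" and P_other: "w \<in> W \<Longrightarrow> P w = 0"
  using component_same[OF split] component_other[OF split] by auto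

lemma decompose: "x \<in> V \<Longrightarrow> x = P x + M x"
  using component_split(2)[OF split] by simp

text \<open>
  This is the \<open>U\<close>-entry of the bicross bracket: \<open>br (M x) (M y)\<close> stays in the subalgebra \<open>W\<close> and
  disappears, and the two mixed terms contribute the action, with a sign from skew symmetry.
\<close>

lemma component_bracket:
  assumes x: "x \<in> V" and y: "y \<in> V"
  shows "P (br x y) = br (P x) (P y) + act (M x) (P y) - act (M y) (P x)"
proof -
  note c = mem_V(1)[OF P_mem[OF x]] mem_V(2)[OF M_mem[OF x]]
    mem_V(1)[OF P_mem[OF y]] mem_V(2)[OF M_mem[OF y]]
  have "br x y = br (P x + M x) (P y + M y)" using decompose x y by simp
  also have "\<dots> = (br (P x) (P y) + br (M x) (P y)) + (br (P x) (M y) + br (M x) (M y))"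
    using bracket_simps c subspace_add[OF subsp(1)] by (simp add: algebra_simps)
  also have "br (P x) (M y) = - br (M y) (P x)" by (rule bracket_skew[OF c(1,4)])
  finally have e: "br x y = (br (P x) (P y) + br (M x) (P y)) + (- br (M y) (P x) + br (M x) (M y))" .
  have n: "- br (M y) (P x) \<in> V" using c bracket_mem subspace_neg[OF subsp(1)] by blast
  have "P (br (M x) (M y)) = 0" using P_other bracket_mem_sub(2) M_mem x y by blast
  moreover have "P (br (P x) (P y)) = br (P x) (P y)" using P_sub bracket_mem_sub(1) P_mem x y by blast
  ultimately show ?thesis
    unfolding e using c n bracket_mem subspace_add[OF subsp(1)]
    by (simp add: P_simps del: add_uminus_conv_diff uminus_add_conv_diff)
qed

text \<open>
  The projection \<open>P\<close> has kernel \<open>W\<close>, and \<open>W\<close> is a subalgebra, so in a bracket with an element of \<open>W\<close>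
  the other entry may be replaced by its \<open>U\<close>-component. This is the step that makes \<open>act\<close> well
  defined on \<open>V / W\<close>.
\<close>

lemma act_component:
  assumes w: "w \<in> W" and x: "x \<in> V"
  shows "act w (P x) = P (br w x)"
proof -
  have s: "P w = 0" "M w = w"
    using P_other w component_same[OF direct_sum_sym[OF split]] by auto
  have z: "br 0 (P x) = 0" "act (M x) 0 = 0"
    using lin_map_zero[OF bracket_lin(2) subsp(1)] lin_map_zero[OF bracket_lin(1) subsp(1)]
      P_other subspace_0[OF subsp(3)] mem_V P_mem M_mem x by auto
  show ?thesis using component_bracket[OF mem_V(2)[OF w] x] s z by simp
qed

lemma sub_lie_algebra: "lie_algebra U br"
proof -
  have "finite_dim_space U"
  proof (rule finite_dim_space_image)
    show "finite_dim_space V" using lie by (simp add: lie_algebra_def)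
    show "lin_map V U P" by (rule component_lin_map[OF split])
    show "P ` V = U" using P_mem P_sub mem_V by (auto intro!: image_eqI[where f = P])
  qed
  moreover have "lin_map U U (br x)" "lin_map U U (\<lambda>y. br y x)" if "x \<in> U" for x
    using bracket_lin[OF mem_V(1)[OF that]] bracket_mem_sub(1) that mem_V
    by (auto simp: lin_map_def)
  ultimately show ?thesis using lie mem_V by (auto simp: lie_algebra_def)
qed

lemma representation: "lie_representation W br U act"
  unfolding lie_representation_def
proof (intro conjI ballI)
  show "lie_algebra W br" by (rule lie_splitting.sub_lie_algebra[OF swapped])
  show "finite_dim_space U" using sub_lie_algebra by (simp add: lie_algebra_def)
  note P = component_lin_map[OF split]
  show "lin_map U U (act x)" if "x \<in> W" for x
    using bracket_lin(1)[OF mem_V(2)[OF that]] P mem_V by (auto simp: lin_map_def Pi_iff)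
  show "lin_map W U (\<lambda>x. act x u)" if "u \<in> U" for u
    using bracket_lin(2)[OF mem_V(1)[OF that]] P mem_V by (auto simp: lin_map_def Pi_iff)
  fix x y u assume xyu: "x \<in> W" "y \<in> W" "u \<in> U"
  note V = mem_V(2)[OF xyu(1)] mem_V(2)[OF xyu(2)] mem_V(1)[OF xyu(3)]
  have "P (br x (br y u)) = P (br (br x y) u) + P (br y (br x u))"
    using bracket_derivation[OF V] V bracket_mem by (simp add: P_simps)
  then show "act (br x y) u = act x (act y u) - act y (act x u)"
    using act_component xyu V bracket_mem by simp
qed

text \<open>The \<open>U\<close>-component of the rule that \<open>br w\<close> is a derivation, evaluated on two elements of \<open>U\<close>.\<close>

lemma compatible:
  assumes u: "u \<in> U" and v: "v \<in> U" and w: "w \<in> W"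
  shows "act w (br u v) - br (act w u) v - br u (act w v)
    + act (M (br u w)) v - act (M (br v w)) u = 0"
proof -
  note V = mem_V(1)[OF u] mem_V(1)[OF v] mem_V(2)[OF w]
  have M_neg: "M (br w x) = - M (br x w)" if "x \<in> V" for x
    using bracket_skew[OF V(3) that] lie_splitting.P_simps(3)[OF swapped] bracket_mem V that
    by metis
  have act_neg: "act (- z) x = - act z x" if "z \<in> V" "x \<in> V" for x z
    using lin_map_neg[OF bracket_lin(2)[OF that(2)] that(1)] P_simps(3) bracket_mem that by metis
  have z: "act 0 x = 0" "M x = 0" "P x = x" if "x \<in> U" for x
    using lin_map_zero[OF bracket_lin(2)[OF mem_V(1)[OF that]] subsp(1)] P_other
      subspace_0[OF subsp(3)] component_other[OF direct_sum_sym[OF split] that] P_sub that by auto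
  have b: "br w u \<in> V" "br w v \<in> V" "br u w \<in> V" "br v w \<in> V" using bracket_mem V by auto
  have m: "M (br u w) \<in> V" "M (br v w) \<in> V" using b M_mem mem_V by auto
  have "act w (br u v) = P (br (br w u) v) + P (br u (br w v))"
    using bracket_derivation[OF V(3,1,2)] V b bracket_mem by (simp add: P_simps)
  also have "P (br (br w u) v) = br (act w u) v - act (M (br u w)) v"
    using component_bracket[OF b(1) V(2)] z v M_neg[OF V(1)] act_neg[OF m(1) V(2)]
      P_mem[OF b(1)] by simp
  also have "P (br u (br w v)) = br u (act w v) + act (M (br v w)) u"
    using component_bracket[OF V(1) b(2)] z u M_neg[OF V(2)] act_neg[OF m(2) V(1)]
      P_mem[OF b(2)] by simp
  finally show ?thesis by simp
qed

end

lemma lie_splitting_bicross_compatible: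
  assumes "lie_splitting V br U W"
  shows "bicross_compatible U br W br (\<lambda>w u. component U W (br w u)) (\<lambda>u w. component W U (br u w))"
  unfolding bicross_compatible_def
  using lie_splitting.compatible[OF assms] lie_splitting.compatible[OF lie_splitting.swapped[OF assms]]
  by blast

lemma lie_splitting_bicross_isomorphism:
  assumes s: "lie_splitting V br U W"
  shows "lie_isomorphism V br
    (U \<times> W) (bicross_bracket br br (\<lambda>w u. component U W (br w u)) (\<lambda>u w. component W U (br u w)))
    (\<lambda>x. (component U W x, component W U x))" (is "lie_isomorphism V br _ ?br' ?F")
proof -
  have L: "lie_algebra V br" and ds: "direct_sum V U W" using s by (auto simp: lie_splitting_def)
  have hom: "?F (br x y) = ?br' (?F x) (?F y)" if "x \<in> V" "y \<in> V" for x y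
    using lie_splitting.component_bracket[OF s that]
      lie_splitting.component_bracket[OF lie_splitting.swapped[OF s] that] by simp
  note F = components_bij(1,2)[OF ds]
  have "?F ` V = U \<times> W" using F(2) by (simp add: bij_betw_def)
  from lie_algebra_image[of V br "U \<times> W" ?F ?br', OF L F(1) this hom]
  show ?thesis using L F hom by (simp add: lie_isomorphism_def)
qed


section \<open>Born encodings in components\<close>

text \<open>
  Compatibility of \<open>h\<close> with \<open>J\<close> makes the restriction of \<open>J\<close> the required isometry; \<open>J\<^sup>2 = -1\<close> gives
  its inverse \<open>-J\<close>, so that the block \<open>-Q\<^sup>-\<^sup>1\<close> of \<open>J\<^sub>Q\<close> is \<open>J\<close> again, restricted to \<open>Vm\<close>.
\<close>

lemma born_encoding_isometry:
  assumes enc: "born_encoding V h J Vp Vm" and sub: "subspace V"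
  shows "linear_isometry Vp h Vm h J"
    and "x \<in> Vm \<Longrightarrow> the_inv_into Vp J x = - J x"
proof -
  have J: "lin_map V V J" and JJ: "\<And>x. x \<in> V \<Longrightarrow> J (J x) = - x"
    and hJ: "\<And>x y. x \<in> V \<Longrightarrow> y \<in> V \<Longrightarrow> h (J x) (J y) = h x y"
    and ds: "direct_sum V Vp Vm" and im: "J ` Vp = Vm" "J ` Vm = Vp"
    using enc by (auto simp: born_encoding_def)
  note V = direct_sum_subset[OF ds]
  have inj: "inj_on J Vp"
  proof (rule inj_onI)
    fix x y assume "x \<in> Vp" "y \<in> Vp" "J x = J y"
    then have "- x = - y" using JJ V by (metis subsetD)
    then show "x = y" by simp
  qed
  have "lin_map Vp Vm J" using J im(1) V unfolding lin_map_def by blast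
  then show "linear_isometry Vp h Vm h J"
    using inj im hJ V by (auto simp: linear_isometry_def bij_betw_def)
  show "the_inv_into Vp J x = - J x" if x: "x \<in> Vm"
  proof (rule the_inv_into_f_eq[OF inj])
    have xV: "x \<in> V" using x V by blast
    show "J (- J x) = x" using lin_map_neg[OF J lin_map_mem[OF J xV]] JJ[OF xV] by simp
    show "- J x \<in> Vp" using x im(2) ds by (auto simp: direct_sum_def subspace_neg)
  qed
qed

lemma components_transport_born_data:
  assumes enc: "born_encoding V h J Vp Vm" and sub: "subspace V"
  defines "F \<equiv> \<lambda>x. (component Vp Vm x, component Vm Vp x)"
  shows "x \<in> V \<Longrightarrow> y \<in> V \<Longrightarrow> sum_form h h (F x) (F y) = h x y"
    and "x \<in> V \<Longrightarrow> J_of_isometry Vp J (F x) = F (J x)"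
proof -
  have h: "bilinear_form V h" and hsym: "\<And>x y. x \<in> V \<Longrightarrow> y \<in> V \<Longrightarrow> h x y = h y x"
    and J: "lin_map V V J"
    and ds: "direct_sum V Vp Vm" and orth: "\<And>x y. x \<in> Vp \<Longrightarrow> y \<in> Vm \<Longrightarrow> h x y = 0"
    and im: "J ` Vp = Vm" "J ` Vm = Vp"
    using enc by (auto simp: born_encoding_def pseudo_riemannian_def)
  note ds' = direct_sum_sym[OF ds]
  note V = direct_sum_subset[OF ds]
  note dec = component_split[OF ds] component_split(1)[OF ds']
  show "sum_form h h (F x) (F y) = h x y" if x: "x \<in> V" and y: "y \<in> V"
  proof -
    let ?a = "component Vp Vm x" and ?b = "component Vm Vp x"
    let ?c = "component Vp Vm y" and ?d = "component Vm Vp y"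
    have m: "?a \<in> V" "?b \<in> V" "?c \<in> V" "?d \<in> V" using dec x y V by blast+
    have o: "h ?a ?d = 0" "h ?b ?c = 0" using orth dec x y hsym[OF m(2,3)] by simp_all
    have "h x y = h (?a + ?b) (?c + ?d)" using dec(2) x y by simp
    also have "\<dots> = h ?a ?c + h ?a ?d + (h ?b ?c + h ?b ?d)"
      using form_simps[OF h sub] m subspace_add[OF sub] by simp
    finally show ?thesis using o by (simp add: F_def)
  qed
  show "J_of_isometry Vp J (F x) = F (J x)" if x: "x \<in> V"
  proof -
    let ?a = "component Vp Vm x" and ?b = "component Vm Vp x"
    have "J x = J (?a + ?b)" using dec(2)[OF x] by simp
    also have "\<dots> = J ?b + J ?a" using lin_map_add[OF J] dec x V by (metis add.commute subsetD)
    finally have e: "J x = J ?b + J ?a" .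
    have m: "J ?b \<in> Vp" "J ?a \<in> Vm" using im dec x by blast+
    have "component Vp Vm (J x) = J ?b" "component Vm Vp (J x) = J ?a"
      using component_add[OF ds m] component_add[OF ds' m(2,1)] by (simp_all add: e add.commute)
    then show ?thesis
      using born_encoding_isometry(2)[OF enc sub dec(3)[OF x]] by (simp add: F_def J_of_isometry_def)
  qed
qed

theorem proposition3p8:
  fixes V :: "'a::real_vector set" and br :: "'a bracket"
    and h :: "'a form" and J :: "'a \<Rightarrow> 'a" and Vp Vm :: "'a set"
  assumes "born_lie_algebra V br"
    and "born_encoding V h J Vp Vm"
    and "integrable_born_structure V br (born_of_encoding h J Vp Vm)"
  shows "\<exists>\<phi> \<rho> Q.
      lie_representation Vm br Vp \<phi> \<and> lie_representation Vp br Vm \<rho>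
      \<and> bicross_compatible Vp br Vm br \<phi> \<rho>
      \<and> linear_isometry Vp h Vm h Q
      \<and> lie_isomorphic V br (Vp \<times> Vm) (bicross_bracket br br \<phi> \<rho>)
      \<and> born_equivalent V br (born_of_encoding h J Vp Vm)
          (Vp \<times> Vm) (bicross_bracket br br \<phi> \<rho>) (associated_born Vp h Vm h Q)"
proof -
  note enc = assms(2)
  have lie: "lie_algebra V br" using assms(1) by (simp add: born_lie_algebra_def)
  have sub: "subspace V" using lie by (simp add: lie_algebra_def finite_dim_space_def)
  have ds: "direct_sum V Vp Vm" and J: "lin_map V V J" using enc by (auto simp: born_encoding_def)
  have born: "born_structure V (born_of_encoding h J Vp Vm)" by (rule born_of_encoding(1)[OF sub enc])
  \<comment> \<open>The summands are recovered from the Born structure as the eigenspaces of its operator \<open>A\<close>.\<close>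
  have "lie_subalgebra V br Vp" "lie_subalgebra V br Vm"
    using assms(3) born_of_encoding(3,4)[OF sub enc] by (auto simp: born_of_encoding_def)
  with lie ds have s: "lie_splitting V br Vp Vm" by unfold_locales
  define \<phi> where "\<phi> = (\<lambda>x u. component Vp Vm (br x u))"
  define \<rho> where "\<rho> = (\<lambda>u x. component Vm Vp (br u x))"
  define F where "F = (\<lambda>x. (component Vp Vm x, component Vm Vp x))"
  have iso: "lie_isomorphism V br (Vp \<times> Vm) (bicross_bracket br br \<phi> \<rho>) F"
    using lie_splitting_bicross_isomorphism[OF s] by (simp add: \<phi>_def \<rho>_def F_def)
  have reps: "lie_representation Vm br Vp \<phi>" "lie_representation Vp br Vm \<rho>"
    using lie_splitting.representation[OF s] lie_splitting.representation[OF lie_splitting.swapped[OF s]]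
    by (simp_all add: \<phi>_def \<rho>_def)
  have compat: "bicross_compatible Vp br Vm br \<phi> \<rho>"
    using lie_splitting_bicross_compatible[OF s] by (simp add: \<phi>_def \<rho>_def)
  let ?J = "J_of_isometry Vp J" and ?h = "sum_form h h"
  have F: "lin_map V (Vp \<times> Vm) F" "bij_betw F V (Vp \<times> Vm)" "F ` Vp = Vp \<times> {0}" "F ` Vm = {0} \<times> Vm"
    using components_bij[OF ds] by (simp_all add: F_def)
  have hF: "?h (F x) (F y) = h x y" and JF: "?J (F x) = F (J x)" if "x \<in> V" "y \<in> V" for x y
    using components_transport_born_data[OF enc sub] that by (simp_all add: F_def)
  have "born_encoding (Vp \<times> Vm) ?h ?J (F ` Vp) (F ` Vm)"
    by (rule born_encoding_image[OF enc sub F(1,2)]) (use hF JF in auto)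
  moreover have "subspace (Vp \<times> Vm)"
    using subspace_lin_map_image[OF F(1) sub] F(2) by (simp add: bij_betw_def)
  ultimately have "born_structure (Vp \<times> Vm) (associated_born Vp h Vm h J)"
    unfolding associated_born_def using born_of_encoding(1) F(3,4) by metis
  moreover have inv: "splitting_involution Vp Vm x \<in> V"
    "splitting_involution (Vp \<times> {0}) ({0} \<times> Vm) (F x) = F (splitting_involution Vp Vm x)"
    if "x \<in> V" for x
    using splitting_involution_image[OF ds F(1,2) sub that] F(3,4) by simp_all
  ultimately have "born_equivalent V br (born_of_encoding h J Vp Vm)
      (Vp \<times> Vm) (bicross_bracket br br \<phi> \<rho>) (associated_born Vp h Vm h J)"
    unfolding associated_born_def born_of_encoding_def born_equivalent.simps
    using born[unfolded born_of_encoding_def] iso lin_map_mem[OF J]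
    by (intro conjI exI[of _ F]) (simp_all add: hF JF)
  then show ?thesis
    using reps compat born_encoding_isometry(1)[OF enc sub] iso unfolding lie_isomorphic_def by blast
qed

end
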